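(* Let $(X^r(t),t\ge 0)$, $r=1,2,\ldots$, be a sequence of Markov processes satisfying properties (1)–(4) of the model in the context, and let $\hat Z^r(\infty)$ be the associated diffusion-scaled steady-state total number of customers. For every subsequential weak limit $\hat Z(\infty)$ of the sequence $\hat Z^r(\infty)$, $r=1,2,\ldots$ (i.e., every random variable that is the limit in distribution of $\hat Z^{r_n}(\infty)$ along some subsequence $r_n\to\infty$), the following properties hold, where $\hat Z^{\pm}(\infty)=(\hat Z(\infty))^{\pm}$. (i) If $\nu_i\le\mu_i$ for all $i\in I$ (including possibly $\nu_i=0$ for some $i$), then there exists $\bar\theta'>0$ such that for every $\theta\in[0,\bar\theta']$ $$\mathbb{E}\exp\Big(\theta\big(\hat Z^-(\infty)\big)^2\Big)<\infty.$$ (ii) Suppose $\nu_i>0$ for all $i\in I$. Then there exists $\bar\theta>0$ such that for every $\theta\in[0,\bar\theta]$ $$\mathbb{E}\exp\Big(\theta\big(\hat Z^+(\infty)\big)^2\Big)<\infty.$$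
   Context: Model. Fix a finite nonempty set $I$ of customer classes, a real $a>0$, and for each $i\in I$ numbers $\lambda_i>0$, $\mu_i>0$, $\nu_i\ge 0$ (arrival, service and abandonment rate parameters), with $\rho_i=\lambda_i/\mu_i$ and $\sum_{i\in I}\rho_i=1$. These are independent of $r$. For $r=1,2,\ldots$ let $N^r=\lceil r+a\sqrt r\rceil$ (number of servers). For each $r$, $(X^r(t),t\ge 0)$ is a continuous-time Markov process (given by its transition rates) on a countable state space $\mathcal{X}^r$ such that: (1) There is a deterministic function $f$ with $f(X^r(t))=\big((Z_i^r(t))_{i\in I},(\Psi_i^r(t))_{i\in I}\big)\in\mathbb{Z}_+^{2|I|}$, where $\Psi_i^r(t)\le Z_i^r(t)$ for all $i$, and every value in the range of $f$ has a finite pre-image. Put $Q_i^r(t)=Z_i^r(t)-\Psi_i^r(t)$. ($Z_i^r$, $\Psi_i^r$, $Q_i^r$ are the numbers of class-$i$ customers in the system, in service, and in queue.) (2) (Non-idling) $\sum_{i}\Psi_i^r(t)=\min\{N^r,\sum_{i}Z_i^r(t)\}$. (3) In any state: (a) for each $\ell\in I$, the total rate of all transitions changing $(Z_i^r)_{i\in I}$ to $(Z_i^r)_{i\in I}+e_\ell$ ($e_\ell$ the $\ell$-th unit vector) is $\lambda_\ell r$; (b) if $Z_\ell^r\ge 1$, the total rate of all transitions changing $(Z_i^r)_{i\in I}$ to $(Z_i^r)_{i\in I}-e_\ell$ is $\mu_\ell\Psi_\ell^r+\nu_\ell Q_\ell^r$; (c) transitions changing some $Z_i^r$ by more than 1,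 or changing more than one component of $(Z_i^r)_{i\in I}$, have zero rate. (Transitions leaving $(Z_i^r)$ unchanged are allowed.) (4) $X^r$ is irreducible. The processes for different $r$ need not be related (the scheduling policy may depend on $r$). Under (1)–(4) the process $X^r$ is non-explosive and positive recurrent with a unique stationary distribution $\pi^r$; the argument $(\infty)$ denotes the value of a variable when $X^r$ is distributed according to $\pi^r$. Diffusion scaling: $\hat Z_i^r=(Z_i^r-\rho_i r)/\sqrt r$, $\hat Z^r=\sum_i\hat Z_i^r$. For real $b$, $b^+=\max(b,0)$, $b^-=-\min(b,0)$. *)

theory Defs
  imports "HOL-Probability.Probability"
begin

section \<open>Continuous-time Markov chains\<close>

text \<open>
  A chain on the countable state space \<open>S\<close> is given by its transition rates \<open>q x y\<close> between distinct
  states (the values \<open>q x x\<close> play no role) together with its transition probabilities: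
  \<open>P t x\<close> is the law at time \<open>t\<close> of the chain started in \<open>x\<close>. That \<open>P t x\<close> has total mass 1 on \<open>S\<close>
  says that the chain is non-explosive.
\<close>

definition exit_rate :: "'x set \<Rightarrow> ('x \<Rightarrow> 'x \<Rightarrow> real) \<Rightarrow> 'x \<Rightarrow> real" where
  "exit_rate S q x = (\<Sum>\<^sub>\<infinity>y\<in>S - {x}. q x y)"

definition generator :: "'x set \<Rightarrow> ('x \<Rightarrow> 'x \<Rightarrow> real) \<Rightarrow> 'x \<Rightarrow> 'x \<Rightarrow> real" where
  "generator S q x y = (if x = y then - exit_rate S q x else q x y)"

definition rate_to :: "'x set \<Rightarrow> ('x \<Rightarrow> 'x \<Rightarrow> real) \<Rightarrow> 'x \<Rightarrow> ('x \<Rightarrow> bool) \<Rightarrow> real" where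
  "rate_to S q x A = (\<Sum>\<^sub>\<infinity>y\<in>{y \<in> S - {x}. A y}. q x y)"

locale markov_chain =
  fixes S :: "'x set" and q :: "'x \<Rightarrow> 'x \<Rightarrow> real" and P :: "real \<Rightarrow> 'x \<Rightarrow> 'x pmf"
  assumes countable_states: "countable S"
    and rate_nonneg: "\<And>x y. x \<in> S \<Longrightarrow> y \<in> S \<Longrightarrow> x \<noteq> y \<Longrightarrow> 0 \<le> q x y"
    and rate_summable: "\<And>x. x \<in> S \<Longrightarrow> q x summable_on (S - {x})"
    and trans_support: "\<And>t x. 0 \<le> t \<Longrightarrow> x \<in> S \<Longrightarrow> set_pmf (P t x) \<subseteq> S"
    and trans_zero: "\<And>x. x \<in> S \<Longrightarrow> P 0 x = return_pmf x"
    and chapman_kolmogorov: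
      "\<And>s t x. 0 \<le> s \<Longrightarrow> 0 \<le> t \<Longrightarrow> x \<in> S \<Longrightarrow> P (s + t) x = bind_pmf (P s x) (P t)"
    and trans_rate:
      "\<And>x y. x \<in> S \<Longrightarrow> y \<in> S \<Longrightarrow>
        ((\<lambda>h. (pmf (P h x) y - pmf (P 0 x) y) / h) \<longlongrightarrow> generator S q x y) (at_right 0)"

definition irreducible_chain :: "'x set \<Rightarrow> ('x \<Rightarrow> 'x \<Rightarrow> real) \<Rightarrow> bool" where
  "irreducible_chain S q \<longleftrightarrow>
     (\<forall>x\<in>S. \<forall>y\<in>S. (x, y) \<in> {(u, v). u \<in> S \<and> v \<in> S \<and> u \<noteq> v \<and> 0 < q u v}\<^sup>*)"

definition stationary_distribution :: "'x set \<Rightarrow> (real \<Rightarrow> 'x \<Rightarrow> 'x pmf) \<Rightarrow> 'x pmf \<Rightarrow> bool" where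
  "stationary_distribution S P p \<longleftrightarrow> set_pmf p \<subseteq> S \<and> (\<forall>t\<ge>0. bind_pmf p (P t) = p)"


section \<open>The multi-class many-server queue\<close>

text \<open>
  \<open>f x = (Z, \<Psi>)\<close>: \<open>Z i\<close> is the number of class-\<open>i\<close> customers in the system and \<open>\<Psi> i\<close> the number of
  those in service.
\<close>

abbreviation in_system :: "('x \<Rightarrow> ('i \<Rightarrow> nat) \<times> ('i \<Rightarrow> nat)) \<Rightarrow> 'x \<Rightarrow> 'i \<Rightarrow> nat" where
  "in_system f x \<equiv> fst (f x)"

abbreviation in_service :: "('x \<Rightarrow> ('i \<Rightarrow> nat) \<times> ('i \<Rightarrow> nat)) \<Rightarrow> 'x \<Rightarrow> 'i \<Rightarrow> nat" where
  "in_service f x \<equiv> snd (f x)"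

definition in_queue :: "('x \<Rightarrow> ('i \<Rightarrow> nat) \<times> ('i \<Rightarrow> nat)) \<Rightarrow> 'x \<Rightarrow> 'i \<Rightarrow> nat" where
  "in_queue f x i = in_system f x i - in_service f x i"

definition num_servers :: "real \<Rightarrow> nat \<Rightarrow> nat" where
  "num_servers a r = nat \<lceil>real r + a * sqrt (real r)\<rceil>"

locale queueing_system = markov_chain S q P
  for S :: "'x set" and q :: "'x \<Rightarrow> 'x \<Rightarrow> real" and P :: "real \<Rightarrow> 'x \<Rightarrow> 'x pmf" +
  fixes lam \<mu> \<nu> :: "'i::finite \<Rightarrow> real" and a :: real and r :: nat
    and f :: "'x \<Rightarrow> ('i \<Rightarrow> nat) \<times> ('i \<Rightarrow> nat)"
  assumes service_le: "\<And>x i. x \<in> S \<Longrightarrow> in_service f x i \<le> in_system f x i"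
    and finite_preimage: "\<And>v. v \<in> f ` S \<Longrightarrow> finite {x \<in> S. f x = v}"
    and non_idling:
      "\<And>x. x \<in> S \<Longrightarrow>
        (\<Sum>i\<in>UNIV. in_service f x i) = min (num_servers a r) (\<Sum>i\<in>UNIV. in_system f x i)"
    and arrival_rate:
      "\<And>x l. x \<in> S \<Longrightarrow>
        rate_to S q x (\<lambda>y. in_system f y = (in_system f x)(l := in_system f x l + 1))
          = lam l * real r"
    and departure_rate:
      "\<And>x l. x \<in> S \<Longrightarrow> 1 \<le> in_system f x l \<Longrightarrow>
        rate_to S q x (\<lambda>y. in_system f y = (in_system f x)(l := in_system f x l - 1))
          = \<mu> l * real (in_service f x l) + \<nu> l * real (in_queue f x l)"
    and no_large_jump:
      "\<And>x y i. x \<in> S \<Longrightarrow> y \<in> S \<Longrightarrow>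
        1 < \<bar>int (in_system f y i) - int (in_system f x i)\<bar> \<Longrightarrow> q x y = 0"
    and no_simultaneous_change:
      "\<And>x y. x \<in> S \<Longrightarrow> y \<in> S \<Longrightarrow>
        1 < card {i. in_system f y i \<noteq> in_system f x i} \<Longrightarrow> q x y = 0"
    and irreducible: "irreducible_chain S q"

definition scaled_class ::
    "('i \<Rightarrow> real) \<Rightarrow> ('i \<Rightarrow> real) \<Rightarrow> nat \<Rightarrow> ('x \<Rightarrow> ('i \<Rightarrow> nat) \<times> ('i \<Rightarrow> nat)) \<Rightarrow> 'x \<Rightarrow> 'i \<Rightarrow> real" where
  "scaled_class lam \<mu> r f x i =
     (real (in_system f x i) - lam i / \<mu> i * real r) / sqrt (real r)"

definition scaled_total ::
    "('i::finite \<Rightarrow> real) \<Rightarrow> ('i \<Rightarrow> real) \<Rightarrow> nat \<Rightarrow> ('x \<Rightarrow> ('i \<Rightarrow> nat) \<times> ('i \<Rightarrow> nat)) \<Rightarrow> 'x \<Rightarrow> real" where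
  "scaled_total lam \<mu> r f x = (\<Sum>i\<in>UNIV. scaled_class lam \<mu> r f x i)"

definition pos_part :: "real \<Rightarrow> real" where
  "pos_part b = max b 0"

definition neg_part :: "real \<Rightarrow> real" where
  "neg_part b = - min b 0"

end

theory Submission
  imports Defs "HOL-Real_Asymp.Real_Asymp"
begin

text \<open>
  Let \<open>h\<close> be the \<open>C\<^sup>1\<close> smoothing of the positive part with \<open>h x = x\<^sup>2 / 2\<close> on \<open>[0, 1]\<close>, let \<open>z\<^sub>i\<close> be the
  diffusion-scaled class sizes and \<open>\<sigma> = -1\<close> in part (i), \<open>\<sigma> = 1\<close> in part (ii). The drift of \<open>z\<^sub>i / \<mu>\<^sub>i\<close> is
  \<open>- z\<^sub>i + (1 - \<nu>\<^sub>i / \<mu>\<^sub>i) q\<^sub>i\<close>, where the scaled queues satisfy \<open>0 \<le> q\<^sub>i\<close> and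
  \<open>\<Sum>q\<^sub>i \<le> (\<Sum>z\<^sub>i)\<^sup>+ \<le> \<Sum>z\<^sub>i\<^sup>+\<close>. If \<open>\<nu>\<^sub>i \<le> \<mu>\<^sub>i\<close>, the queue term only helps against negative \<open>z\<^sub>i\<close>;
  if \<open>\<nu>\<^sub>i \<ge> \<epsilon> \<mu>\<^sub>i\<close>, it cancels at most a fraction \<open>1 - \<epsilon>\<close> of the restoring drift of \<open>\<Sum>z\<^sub>i\<^sup>+\<close>.
  In both cases \<open>V = exp (t \<Sum>h(\<sigma> z\<^sub>i) / \<mu>\<^sub>i)\<close> satisfies, for \<open>r\<close> large depending on \<open>t\<close>,
  \<open>LV \<le> V (- \<eta> t Y + c (t + t\<^sup>2))\<close> with \<open>Y = \<Sum>(\<sigma> z\<^sub>i)\<^sup>+\<close>. Stationarity then bounds \<open>E exp (t Y)\<close> by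
  \<open>2 exp (A (t + t\<^sup>2))\<close> for every \<open>t > 0\<close>; this passes to weak limits, and sub-Gaussian growth of the
  moment generating function is equivalent to a finite Gaussian moment.
\<close>

section \<open>Stationary drift of a Markov chain\<close>

context markov_chain
begin

text \<open>
  Only the inequality \<open>p Q \<le> 0\<close> is needed, and for it a finite form of Fatou's lemma suffices:
  dropping the inflow from outside \<open>F\<close> in \<open>p = p P\<^sub>h\<close> only decreases it.
\<close>

lemma stationary_generator_le:
  assumes p: "stationary_distribution S P p" and F: "finite F" "F \<subseteq> S" and y: "y \<in> F"
  shows "(\<Sum>x\<in>F. pmf p x * generator S q x y) \<le> 0"
proof (rule tendsto_upperbound)
  show "((\<lambda>h. \<Sum>x\<in>F. pmf p x * ((pmf (P h x) y - pmf (P 0 x) y) / h)) \<longlongrightarrow>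
      (\<Sum>x\<in>F. pmf p x * generator S q x y)) (at_right 0)"
    using F y by (intro tendsto_intros trans_rate) auto
  show "\<forall>\<^sub>F h in at_right 0. (\<Sum>x\<in>F. pmf p x * ((pmf (P h x) y - pmf (P 0 x) y) / h)) \<le> 0"
  proof (rule eventually_at_right_less[THEN eventually_mono])
    fix h :: real assume h: "0 < h"
    have "(\<Sum>x\<in>F. pmf p x * pmf (P h x) y) = (\<integral>x. indicator F x * pmf (P h x) y \<partial>measure_pmf p)"
      using F by (subst integral_measure_pmf_real[of F]) (auto simp: mult.commute intro!: sum.cong split: split_indicator_asm)
    also have "\<dots> \<le> (\<integral>x. pmf (P h x) y \<partial>measure_pmf p)"
      by (rule integral_mono)
        (auto intro!: measure_pmf.integrable_const_bound[where B = 1] simp: pmf_le_1 split: split_indicator)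
    also have "\<dots> = pmf (bind_pmf p (P h)) y"
      by (simp add: pmf_bind)
    also have "\<dots> = pmf p y"
      using p h by (simp add: stationary_distribution_def)
    also have "\<dots> = (\<Sum>x\<in>F. pmf p x * pmf (P 0 x) y)"
    proof -
      have "(\<Sum>x\<in>F. pmf p x * pmf (P 0 x) y) = (\<Sum>x\<in>F. if x = y then pmf p x else 0)"
        using F by (intro sum.cong) (auto simp: trans_zero subset_iff)
      then show ?thesis
        using F y by (simp add: sum.delta')
    qed
    finally have "(\<Sum>x\<in>F. pmf p x * (pmf (P h x) y - pmf (P 0 x) y)) \<le> 0"
      by (simp add: right_diff_distrib sum_subtractf)
    then have "(\<Sum>x\<in>F. pmf p x * (pmf (P h x) y - pmf (P 0 x) y)) / h \<le> 0"
      using h by (simp add: divide_le_0_iff)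
    then show "(\<Sum>x\<in>F. pmf p x * ((pmf (P h x) y - pmf (P 0 x) y) / h)) \<le> 0"
      by (simp add: sum_divide_distrib)
  qed
qed simp

text \<open>On a finite set \<open>F\<close> everything is a finite sum. Since \<open>C - u\<close>
  vanishes off \<open>F\<close>, the drift of \<open>u\<close> at a point of \<open>F\<close> is
  minus the generator applied to \<open>C - u\<close>, summed over \<open>F\<close> only. Swapping
  the two finite sums leaves \<open>p Q \<le> 0\<close> weighted by the nonnegative numbers
  \<open>C - u y\<close>.\<close>

lemma stationary_drift_nonneg:
  assumes p: "stationary_distribution S P p"
    and u: "\<And>x. x \<in> S \<Longrightarrow> u x \<le> C" and F: "finite {x \<in> S. u x < C}"
  shows "0 \<le> (\<Sum>x | x \<in> S \<and> u x < C. pmf p x * (\<Sum>\<^sub>\<infinity>y\<in>S - {x}. q x y * (u y - u x)))"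
proof -
  define F where "F = {x \<in> S. u x < C}"
  have fin: "finite F" and FS: "F \<subseteq> S"
    using F by (auto simp: F_def)
  have u_off: "u y = C" if "y \<in> S - F" for y
    using that u[of y] by (auto simp: F_def)
  have drift: "(\<Sum>\<^sub>\<infinity>y\<in>S - {x}. q x y * (u y - u x)) = - (\<Sum>y\<in>F. generator S q x y * (C - u y))"
    if x: "x \<in> F" for x
  proof -
    have xS: "x \<in> S" using x FS by auto
    \<comment> \<open>Splitting \<open>u y - u x\<close> as \<open>(C - u x) + (u y - C)\<close>
      leaves a constant, summed by the exit rate, and a function supported in
      \<open>F\<close>.\<close>
    have s1: "((\<lambda>y. q x y * (C - u x)) has_sum exit_rate S q x * (C - u x)) (S - {x})"
      unfolding exit_rate_def by (intro has_sum_cmult_left has_sum_infsum rate_summable xS)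
    have "((\<lambda>y. q x y * (u y - C)) has_sum (\<Sum>y\<in>F - {x}. q x y * (u y - C))) (F - {x})"
      using fin by (intro has_sum_finite) auto
    then have s2: "((\<lambda>y. q x y * (u y - C)) has_sum (\<Sum>y\<in>F - {x}. q x y * (u y - C))) (S - {x})"
      by (rule has_sum_cong_neutral[THEN iffD1, rotated -1]) (use u_off FS in auto)
    have "(\<Sum>\<^sub>\<infinity>y\<in>S - {x}. q x y * (u y - u x)) =
        exit_rate S q x * (C - u x) + (\<Sum>y\<in>F - {x}. q x y * (u y - C))"
      using infsumI[OF has_sum_add[OF s1 s2]] by (simp add: algebra_simps)
    moreover have "(\<Sum>y\<in>F. generator S q x y * (C - u y)) =
        - exit_rate S q x * (C - u x) + (\<Sum>y\<in>F - {x}. q x y * (C - u y))"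
    proof -
      have "(\<Sum>y\<in>F - {x}. generator S q x y * (C - u y)) = (\<Sum>y\<in>F - {x}. q x y * (C - u y))"
        by (intro sum.cong) (auto simp: generator_def)
      then show ?thesis
        using fin x by (simp add: sum.remove[of F x] generator_def)
    qed
    moreover have "(\<Sum>y\<in>F - {x}. q x y * (u y - C)) = - (\<Sum>y\<in>F - {x}. q x y * (C - u y))"
      by (simp add: sum_negf[symmetric] algebra_simps)
    ultimately show ?thesis
      by simp
  qed
  have "(\<Sum>x\<in>F. pmf p x * (\<Sum>\<^sub>\<infinity>y\<in>S - {x}. q x y * (u y - u x))) =
      - (\<Sum>x\<in>F. \<Sum>y\<in>F. (C - u y) * (pmf p x * generator S q x y))"
    by (simp add: drift sum_distrib_left sum_negf mult_ac)
  also have "\<dots> = - (\<Sum>y\<in>F. (C - u y) * (\<Sum>x\<in>F. pmf p x * generator S q x y))"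
    by (subst sum.swap) (simp add: sum_distrib_left)
  finally have "(\<Sum>x\<in>F. pmf p x * (\<Sum>\<^sub>\<infinity>y\<in>S - {x}. q x y * (u y - u x))) = \<dots>" .
  moreover have "(\<Sum>y\<in>F. (C - u y) * (\<Sum>x\<in>F. pmf p x * generator S q x y)) \<le> 0"
    using u FS by (intro sum_nonpos mult_nonneg_nonpos stationary_generator_le[OF p fin FS]) auto
  ultimately show ?thesis
    by (simp add: F_def)
qed

end

section \<open>A smooth positive part\<close>

definition ramp :: "real \<Rightarrow> real" where
  "ramp x = max 0 (min 1 x)"

text \<open>This is the maximum of \<open>c * x - c^2 / 2\<close> over \<open>c\<close> in
  \<open>[0, 1]\<close>, attained at \<open>c = ramp x\<close>. Hence it is convex with derivative
  \<open>ramp\<close>, vanishes for \<open>x \<le> 0\<close> and equals \<open>x - 1 / 2\<close> for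
  \<open>x \<ge> 1\<close>.\<close>

definition smooth_pos :: "real \<Rightarrow> real" where
  "smooth_pos x = x * ramp x - (ramp x)\<^sup>2 / 2"

lemma ramp_nonneg: "0 \<le> ramp x" and ramp_le_1: "ramp x \<le> 1"
  by (auto simp: ramp_def)

lemma ramp_Lipschitz: "\<bar>ramp y - ramp x\<bar> \<le> \<bar>y - x\<bar>"
  by (auto simp: ramp_def)

text \<open>\<open>ramp x\<close> is the projection of \<open>x\<close> onto \<open>[0, 1]\<close>,
  so \<open>(ramp x - c) * (x - ramp x)\<close> is nonnegative for every \<open>c\<close> in the
  interval. The difference of the two sides is this product plus half of
  \<open>(ramp x - c)^2\<close>.\<close>

lemma smooth_pos_ge_affine:
  assumes "0 \<le> c" "c \<le> 1"
  shows "c * x - c\<^sup>2 / 2 \<le> smooth_pos x"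
proof -
  define d where "d = ramp x"
  have "0 \<le> (d - c) * (x - d)"
  proof -
    consider "x \<le> 0" | "0 \<le> x" "x \<le> 1" | "1 \<le> x" by linarith
    then show ?thesis
      using assms by cases (auto simp: d_def ramp_def mult_nonneg_nonpos)
  qed
  moreover have "0 \<le> (d - c)\<^sup>2" by simp
  ultimately show ?thesis
    unfolding smooth_pos_def d_def[symmetric] by (simp add: power2_eq_square algebra_simps)
qed

text \<open>The affine minorant with slope \<open>ramp y\<close> touches \<open>smooth_pos\<close>
  at \<open>y\<close>; it is evaluated at \<open>x\<close>.\<close>

lemma smooth_pos_diff_le: "smooth_pos y - smooth_pos x \<le> ramp y * (y - x)"
  using smooth_pos_ge_affine[OF ramp_nonneg ramp_le_1, of y x] by (simp add: smooth_pos_def[of y] algebra_simps)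

lemma smooth_pos_nonneg: "0 \<le> smooth_pos x"
  using smooth_pos_ge_affine[of 0 x] by simp

lemma smooth_pos_ge: "max x 0 - 1 / 2 \<le> smooth_pos x"
  using smooth_pos_ge_affine[of 1 x] smooth_pos_nonneg[of x] by auto

lemma ramp_mult_ge: "max x 0 - 1 \<le> ramp x * x"
proof -
  have "smooth_pos x \<le> ramp x * x" by (simp add: smooth_pos_def)
  then show ?thesis using smooth_pos_ge[of x] by linarith
qed

lemma smooth_pos_le: "smooth_pos x \<le> max x 0"
proof -
  have "ramp x * x \<le> max x 0"
    by (auto simp: ramp_def max_def min_def mult_left_le_one_le)
  then show ?thesis
    by (simp add: smooth_pos_def mult.commute[of x] add_increasing2 diff_le_eq)
qed

lemma smooth_pos_Lipschitz: "\<bar>smooth_pos y - smooth_pos x\<bar> \<le> \<bar>y - x\<bar>"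
proof -
  have "smooth_pos y - smooth_pos x \<le> \<bar>y - x\<bar>" for x y
  proof -
    have "ramp y * (y - x) \<le> 1 * \<bar>y - x\<bar>"
      using ramp_nonneg[of y] ramp_le_1[of y]
      by (intro order_trans[OF mult_left_mono mult_right_mono]) auto
    then show ?thesis using order_trans[OF smooth_pos_diff_le] by simp
  qed
  from this[of x y] this[of y x] show ?thesis by linarith
qed

text \<open>A second-order Taylor bound without a second derivative: moving the slope from
  \<open>y\<close> back to \<open>x\<close> costs at most \<open>(y - x)^2\<close>, because
  \<open>ramp\<close> is 1-Lipschitz.\<close>

lemma smooth_pos_quadratic_upper: "smooth_pos y - smooth_pos x \<le> ramp x * (y - x) + (y - x)\<^sup>2"
proof -
  have "(ramp y - ramp x) * (y - x) \<le> \<bar>ramp y - ramp x\<bar> * \<bar>y - x\<bar>"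
    by (metis abs_ge_self abs_mult)
  also have "\<dots> \<le> \<bar>y - x\<bar> * \<bar>y - x\<bar>"
    by (intro mult_right_mono ramp_Lipschitz) simp
  finally show ?thesis
    using smooth_pos_diff_le[of y x] by (simp add: power2_eq_square left_diff_distrib)
qed

lemma exp_le_quadratic:
  fixes x :: real
  assumes "x \<le> 1"
  shows "exp x \<le> 1 + x + x\<^sup>2"
proof (cases "0 \<le> x")
  case True
  then show ?thesis using exp_bound[of x] assms by simp
next
  case False
  have "x * x\<^sup>2 \<le> 0"
    using False by (intro mult_nonpos_nonneg) auto
  \<comment> \<open>The product is \<open>1 - x^3\<close>.\<close>
  then have "1 \<le> (1 - x) * (1 + x + x\<^sup>2)"
    by (simp add: power2_eq_square algebra_simps)
  also have "\<dots> \<le> exp (- x) * (1 + x + x\<^sup>2)"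
  proof (rule mult_right_mono)
    show "1 - x \<le> exp (- x)"
      using exp_ge_add_one_self[of "- x"] by simp
    have "0 \<le> (1 + 2 * x)\<^sup>2 + 3" by simp
    then show "0 \<le> 1 + x + x\<^sup>2"
      by (simp add: power2_eq_square algebra_simps)
  qed
  finally have "1 \<le> (1 + x + x\<^sup>2) / exp x"
    by (simp add: exp_minus field_simps)
  then show ?thesis
    by (simp add: field_simps)
qed

text \<open>Of the second-order error, \<open>s\<close> comes from the curvature of
  \<open>smooth_pos\<close> and \<open>s^2\<close> from the quadratic term of the
  exponential.\<close>

lemma exp_smooth_pos_increment:
  assumes "0 \<le> s" "s * \<bar>y - x\<bar> \<le> 1"
  shows "exp (s * (smooth_pos y - smooth_pos x)) - 1 \<le> s * ramp x * (y - x) + (s + s\<^sup>2) * (y - x)\<^sup>2"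
proof -
  define D where "D = smooth_pos y - smooth_pos x"
  have abs: "\<bar>s * D\<bar> \<le> s * \<bar>y - x\<bar>"
    using smooth_pos_Lipschitz[of y x] \<open>0 \<le> s\<close> by (simp add: D_def abs_mult mult_left_mono)
  have "exp (s * D) - 1 \<le> s * D + (s * D)\<^sup>2"
    using exp_le_quadratic[of "s * D"] abs assms(2) by linarith
  moreover have "s * D \<le> s * (ramp x * (y - x) + (y - x)\<^sup>2)"
    using smooth_pos_quadratic_upper[of y x] \<open>0 \<le> s\<close> by (intro mult_left_mono) (auto simp: D_def)
  moreover have "(s * D)\<^sup>2 \<le> (s * (y - x))\<^sup>2"
    using abs \<open>0 \<le> s\<close> by (simp add: abs_le_square_iff[symmetric] abs_mult)
  moreover have "s * (ramp x * (y - x) + (y - x)\<^sup>2) + (s * (y - x))\<^sup>2 =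
      s * ramp x * (y - x) + (s + s\<^sup>2) * (y - x)\<^sup>2"
    unfolding power_mult_distrib by (simp add: distrib_left distrib_right)
  ultimately have "exp (s * D) - 1 \<le> s * ramp x * (y - x) + (s + s\<^sup>2) * (y - x)\<^sup>2"
    by linarith
  then show ?thesis
    by (simp add: D_def)
qed

section \<open>Drift in the queueing system\<close>

lemma has_sum_finite_sum:
  fixes g :: "'l \<Rightarrow> 'a \<Rightarrow> real"
  assumes "finite L" "\<And>l. l \<in> L \<Longrightarrow> (g l has_sum c l) A"
  shows "((\<lambda>y. \<Sum>l\<in>L. g l y) has_sum (\<Sum>l\<in>L. c l)) A"
  using assms by (induction L rule: finite_induct) (auto intro!: has_sum_add has_sum_0)

section \<open>The generator on functions of the class sizes\<close>

context queueing_system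
begin

definition departure :: "'x \<Rightarrow> 'i \<Rightarrow> real" where
  "departure x l = \<mu> l * real (in_service f x l) + \<nu> l * real (in_queue f x l)"

text \<open>
  At \<open>z l = 0\<close> the truncated subtraction \<open>z l - 1\<close> makes the departure term vanish.
\<close>

definition drift :: "(('i \<Rightarrow> nat) \<Rightarrow> real) \<Rightarrow> 'x \<Rightarrow> real" where
  "drift H x = (let z = in_system f x in
     \<Sum>l\<in>UNIV. lam l * real r * (H (z(l := z l + 1)) - H z)
       + departure x l * (H (z(l := z l - 1)) - H z))"

lemma departure_empty:
  assumes "x \<in> S" "in_system f x l = 0"
  shows "departure x l = 0"
  using service_le[OF assms(1), of l] assms(2) by (simp add: departure_def in_queue_def)

lemma jump_cases:
  assumes x: "x \<in> S" and y: "y \<in> S" and pos: "q x y \<noteq> 0"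
  obtains "in_system f y = in_system f x"
    | k where "in_system f y = (in_system f x)(k := in_system f x k + 1)"
    | k where "1 \<le> in_system f x k" "in_system f y = (in_system f x)(k := in_system f x k - 1)"
proof (cases "in_system f y = in_system f x")
  case False
  have "card {i. in_system f y i \<noteq> in_system f x i} \<noteq> 0"
    using False by (auto simp: fun_eq_iff)
  moreover have "\<not> 1 < card {i. in_system f y i \<noteq> in_system f x i}"
    using no_simultaneous_change[OF x y] pos by auto
  ultimately have "card {i. in_system f y i \<noteq> in_system f x i} = 1"
    by linarith
  then obtain k where k: "{i. in_system f y i \<noteq> in_system f x i} = {k}"
    by (auto simp: card_1_singleton_iff)
  then have upd: "in_system f y = (in_system f x)(k := in_system f y k)"
    by (auto simp: fun_eq_iff set_eq_iff)
  have "in_system f y k \<noteq> in_system f x k"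
    using k by auto
  moreover have "\<not> 1 < \<bar>int (in_system f y k) - int (in_system f x k)\<bar>"
    using no_large_jump[OF x y] pos by auto
  ultimately consider "in_system f y k = in_system f x k + 1"
    | "1 \<le> in_system f x k" "in_system f y k = in_system f x k - 1"
    by linarith
  then show ?thesis
    using that(2)[of k] that(3)[of k] upd by cases auto
qed (rule that(1))

lemma rate_to_has_sum:
  assumes x: "x \<in> S"
  shows "((\<lambda>y. of_bool (A y) * q x y) has_sum rate_to S q x A) (S - {x})"
proof -
  have "q x summable_on {y \<in> S - {x}. A y}"
    by (rule summable_on_subset[OF rate_summable[OF x]]) auto
  then have "(q x has_sum rate_to S q x A) {y \<in> S - {x}. A y}"
    unfolding rate_to_def by (rule has_sum_infsum)
  then show ?thesis
    by (rule has_sum_cong_neutral[THEN iffD1, rotated -1]) auto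
qed

text \<open>The summands depend on \<open>y\<close> only through its class vector, so the targets
  can be grouped by that vector. Internal transitions contribute nothing, and each neighbouring
  vector collects exactly the total rate prescribed by the model.\<close>

lemma generator_eq_drift:
  assumes x: "x \<in> S"
  shows "(\<Sum>\<^sub>\<infinity>y\<in>S - {x}. q x y * (H (in_system f y) - H (in_system f x))) = drift H x"
proof -
  define z where "z = in_system f x"
  define U where "U l = z(l := z l + 1)" for l
  define D where "D l = z(l := z l - 1)" for l
  have UU: "U l = U k \<longleftrightarrow> l = k" for l k
    by (auto simp: U_def fun_eq_iff split: if_splits)
  have DD: "D l = D k \<longleftrightarrow> l = k" if "1 \<le> z l" "1 \<le> z k" for l k
    using that by (auto simp: D_def fun_eq_iff split: if_splits)
  have UD: "U l \<noteq> D k" for l k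
  proof
    assume "U l = D k"
    then have "U l l = D k l" by simp
    then show False by (auto simp: U_def D_def split: if_splits)
  qed
  have Uz: "U l \<noteq> z" for l
    by (auto simp: U_def fun_eq_iff)
  have Dz: "D l \<noteq> z" if "1 \<le> z l" for l
    using that by (auto simp: D_def fun_eq_iff)
  \<comment> \<open>The guard \<open>1 \<le> z l\<close> keeps the vectors in use distinct: for
    \<open>z l = 0\<close> truncated subtraction gives \<open>D l = z\<close>. An empty class has
    departure rate zero, so the guard changes nothing in the total.\<close>
  let ?T = "\<lambda>y. \<Sum>l\<in>UNIV. of_bool (in_system f y = U l) * q x y * (H (U l) - H z)
     + of_bool (1 \<le> z l \<and> in_system f y = D l) * q x y * (H (D l) - H z)"
  have decomp: "q x y * (H (in_system f y) - H z) = ?T y" if y: "y \<in> S" for y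
  proof (cases "q x y = 0")
    case False
    show ?thesis
    proof (rule jump_cases[OF x y False])
      assume "in_system f y = in_system f x"
      then have z: "in_system f y = z"
        by (simp add: z_def)
      have "?T y = 0"
        using Uz[symmetric] Dz[symmetric] by (intro sum.neutral) (auto simp: z)
      then show ?thesis
        by (simp add: z)
    next
      fix k assume "in_system f y = (in_system f x)(k := in_system f x k + 1)"
      then have k: "in_system f y = U k"
        by (simp add: U_def z_def)
      have "?T y = (\<Sum>l\<in>UNIV. if l = k then q x y * (H (U k) - H z) else 0)"
        by (intro sum.cong) (auto simp: k UU UD)
      then show ?thesis
        by (simp add: k)
    next
      fix k assume k1: "1 \<le> in_system f x k"
        and "in_system f y = (in_system f x)(k := in_system f x k - 1)"
      then have k: "in_system f y = D k" "1 \<le> z k"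
        by (simp_all add: D_def z_def)
      have "?T y = (\<Sum>l\<in>UNIV. if l = k then q x y * (H (D k) - H z) else 0)"
        using k DD UD[symmetric] by (intro sum.cong) auto
      then show ?thesis
        by (simp add: k)
    qed
  qed simp
  have up: "((\<lambda>y. of_bool (in_system f y = U l) * q x y * (H (U l) - H z)) has_sum
      lam l * real r * (H (U l) - H z)) (S - {x})" for l
    using has_sum_cmult_left[OF rate_to_has_sum[OF x, of "\<lambda>y. in_system f y = U l"], of "H (U l) - H z"]
    unfolding U_def z_def arrival_rate[OF x, of l] .
  have down: "((\<lambda>y. of_bool (1 \<le> z l \<and> in_system f y = D l) * q x y * (H (D l) - H z)) has_sum
      departure x l * (H (D l) - H z)) (S - {x})" for l
  proof (cases "1 \<le> z l")
    case True
    have "((\<lambda>y. of_bool (in_system f y = D l) * q x y * (H (D l) - H z)) has_sum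
      departure x l * (H (D l) - H z)) (S - {x})"
      using has_sum_cmult_left[OF rate_to_has_sum[OF x, of "\<lambda>y. in_system f y = D l"], of "H (D l) - H z"]
      unfolding D_def z_def departure_def departure_rate[OF x True[unfolded z_def]] .
    then show ?thesis
      using True by simp
  next
    case False
    then show ?thesis
      using departure_empty[OF x, of l] by (simp add: z_def)
  qed
  have "(?T has_sum drift H x) (S - {x})"
    unfolding drift_def Let_def z_def[symmetric] U_def[symmetric] D_def[symmetric]
    by (intro has_sum_finite_sum has_sum_add up down) simp
  then have "((\<lambda>y. q x y * (H (in_system f y) - H z)) has_sum drift H x) (S - {x})"
    by (rule has_sum_cong[THEN iffD1, rotated]) (use decomp in auto)
  then show ?thesis
    unfolding z_def by (rule infsumI)
qed

text \<open>A maximum principle: the increments carry nonnegative rates, so a majorant touching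
  \<open>H\<close> at the current state has the larger drift. It removes the truncation
  \<open>min _ C\<close> below.\<close>

lemma drift_mono:
  assumes "x \<in> S" "\<And>l. 0 \<le> lam l" "\<And>l. 0 \<le> \<mu> l" "\<And>l. 0 \<le> \<nu> l"
    and "\<And>z. H z \<le> K z" "H (in_system f x) = K (in_system f x)"
  shows "drift H x \<le> drift K x"
  using assms unfolding drift_def Let_def departure_def
  by (intro sum_mono add_mono mult_left_mono) auto

section \<open>A Foster-Lyapunov bound for the stationary law\<close>

definition in_total :: "('i \<Rightarrow> nat) \<Rightarrow> nat" where
  "in_total z = (\<Sum>i\<in>UNIV. z i)"

lemma finite_bounded_states: "finite {x \<in> S. in_total (in_system f x) \<le> k}"
proof -
  define B where "B = (UNIV :: 'i set) \<rightarrow>\<^sub>E {..k}"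
  have B: "finite B"
    unfolding B_def by (intro finite_PiE) auto
  have "{x \<in> S. in_total (in_system f x) \<le> k} \<subseteq>
      (\<Union>v \<in> (B \<times> B) \<inter> f ` S. {x \<in> S. f x = v})"
  proof
    fix x assume "x \<in> {x \<in> S. in_total (in_system f x) \<le> k}"
    then have x: "x \<in> S" and le: "(\<Sum>i\<in>UNIV. in_system f x i) \<le> k"
      by (auto simp: in_total_def)
    have Z: "in_system f x i \<le> k" for i
      using member_le_sum[of i UNIV "in_system f x"] le by simp
    then have "in_service f x i \<le> k" for i
      using service_le[OF x, of i] order_trans by blast
    with Z have "f x \<in> B \<times> B"
      by (auto simp: B_def mem_Times_iff PiE_UNIV_domain)
    then show "x \<in> (\<Union>v \<in> (B \<times> B) \<inter> f ` S. {x \<in> S. f x = v})"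
      using x by auto
  qed
  then show ?thesis
    by (rule finite_subset) (use B finite_preimage in \<open>auto intro!: finite_UN_I\<close>)
qed

text \<open>Departures never raise the total, so only arrivals contribute to the added drift, and
  their total rate does not depend on the state.\<close>

lemma drift_perturb:
  "drift (\<lambda>z. V z + \<epsilon> * real (in_total z)) x \<le> drift V x + \<epsilon> * (\<Sum>l\<in>UNIV. lam l * real r)"
  if "x \<in> S" "0 \<le> \<epsilon>" "\<And>l. 0 \<le> \<mu> l" "\<And>l. 0 \<le> \<nu> l"
proof -
  have tot: "in_total (z(l := k)) + z l = in_total z + k" for z l k
    unfolding in_total_def
    by (subst (1 2) sum.remove[of UNIV l]) (auto intro!: sum.cong)
  let ?z = "in_system f x"
  have up: "real (in_total (?z(l := ?z l + 1))) = real (in_total ?z) + 1" for l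
    using tot[of ?z l "?z l + 1"] by simp
  have dn: "real (in_total (?z(l := ?z l - 1))) \<le> real (in_total ?z)" for l
    using tot[of ?z l "?z l - 1"] by simp
  have D: "0 \<le> departure x l" for l
    using that by (simp add: departure_def)
  have "lam l * real r * (V (?z(l := ?z l + 1)) + \<epsilon> * real (in_total (?z(l := ?z l + 1))) - (V ?z + \<epsilon> * real (in_total ?z)))
       + departure x l * (V (?z(l := ?z l - 1)) + \<epsilon> * real (in_total (?z(l := ?z l - 1))) - (V ?z + \<epsilon> * real (in_total ?z)))
    \<le> lam l * real r * (V (?z(l := ?z l + 1)) - V ?z) + departure x l * (V (?z(l := ?z l - 1)) - V ?z)
      + \<epsilon> * (lam l * real r)" for l
  proof -
    have "departure x l * (\<epsilon> * (real (in_total (?z(l := ?z l - 1))) - real (in_total ?z))) \<le> 0"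
      using D[of l] dn[of l] \<open>0 \<le> \<epsilon>\<close> by (intro mult_nonneg_nonpos) auto
    then show ?thesis
      unfolding up by (simp add: algebra_simps)
  qed
  then show ?thesis
    unfolding drift_def Let_def sum_distrib_left sum.distrib[symmetric]
    by (intro sum_mono) blast
qed

text \<open>
  The drift inequality is applied to \<open>min (V + \<epsilon> |z|) C\<close>, which differs from \<open>C\<close> at finitely many states
  only; \<open>\<epsilon> |z|\<close> is needed when \<open>V\<close> does not grow at infinity.
\<close>

theorem foster_lyapunov:
  assumes p: "stationary_distribution S P p"
    and rates: "\<And>l. 0 \<le> lam l" "\<And>l. 0 \<le> \<mu> l" "\<And>l. 0 \<le> \<nu> l"
    and V: "\<And>z. 0 \<le> V z" and \<kappa>: "0 < \<kappa>" and B: "0 \<le> B"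
    and dr: "\<And>x. x \<in> S \<Longrightarrow> drift V x \<le> \<kappa> * (B - V (in_system f x))"
  shows "(\<integral>\<^sup>+x. ennreal (V (in_system f x)) \<partial>measure_pmf p) \<le> ennreal B"
proof -
  let ?Z = "in_system f"
  define L where "L = (\<Sum>l\<in>UNIV. lam l * real r)"
  have L: "0 \<le> L"
    using rates by (auto simp: L_def intro!: sum_nonneg)
  have pS: "set_pmf p \<subseteq> S"
    using p by (simp add: stationary_distribution_def)
  have prob: "(\<Sum>x\<in>F. pmf p x) \<le> 1" if "finite F" for F
    using that measure_pmf.prob_le_1[of p F] by (simp add: measure_measure_pmf_finite)
  have bound_eps: "(\<Sum>x\<in>A. pmf p x * V (?Z x)) \<le> B + \<epsilon> * (L / \<kappa>)"
    if A: "finite A" "A \<subseteq> S" "A \<noteq> {}" and \<epsilon>: "0 < \<epsilon>" for A \<epsilon>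
  proof -
    define H where "H = (\<lambda>z. V z + \<epsilon> * real (in_total z))"
    \<comment> \<open>\<open>C\<close> lies strictly above \<open>H\<close> on \<open>A\<close>, so
      that truncation at \<open>C\<close> leaves \<open>A\<close> inside \<open>F\<close>.\<close>
    define C where "C = Max ((H \<circ> ?Z) ` A) + 1"
    define F where "F = {x \<in> S. min (H (?Z x)) C < C}"
    have F_eq: "F = {x \<in> S. H (?Z x) < C}"
      by (auto simp: F_def)
    have AF: "A \<subseteq> F"
    proof
      fix x assume "x \<in> A"
      then have "H (?Z x) \<le> Max ((H \<circ> ?Z) ` A)"
        using A by (intro Max_ge) auto
      then have "H (?Z x) < C"
        by (simp add: C_def)
      then show "x \<in> F"
        using \<open>x \<in> A\<close> A by (auto simp: F_eq)
    qed
    \<comment> \<open>As \<open>V\<close> is nonnegative, \<open>H < C\<close> already bounds the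
      total number of customers.\<close>
    have "F \<subseteq> {x \<in> S. in_total (?Z x) \<le> nat \<lceil>C / \<epsilon>\<rceil>}"
    proof
      fix x assume "x \<in> F"
      then have "x \<in> S" and "\<epsilon> * real (in_total (?Z x)) < C"
        using V[of "?Z x"] by (auto simp: F_eq H_def)
      then have "real (in_total (?Z x)) \<le> C / \<epsilon>"
        using \<epsilon> by (simp add: field_simps)
      then show "x \<in> {x \<in> S. in_total (?Z x) \<le> nat \<lceil>C / \<epsilon>\<rceil>}"
        using \<open>x \<in> S\<close> by (simp add: le_nat_iff) linarith
    qed
    then have finF: "finite F"
      using finite_bounded_states finite_subset by blast
    have "0 \<le> (\<Sum>x\<in>F. pmf p x * (\<Sum>\<^sub>\<infinity>y\<in>S - {x}. q x y * (min (H (?Z y)) C - min (H (?Z x)) C)))"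
      using stationary_drift_nonneg[OF p, of "\<lambda>x. min (H (?Z x)) C" C] finF by (simp add: F_def)
    also have "\<dots> \<le> (\<Sum>x\<in>F. pmf p x * (\<kappa> * B + \<epsilon> * L - \<kappa> * V (?Z x)))"
    proof (intro sum_mono mult_left_mono)
      fix x assume xF: "x \<in> F"
      then have x: "x \<in> S" and lt: "H (?Z x) < C"
        by (auto simp: F_eq)
      have "(\<Sum>\<^sub>\<infinity>y\<in>S - {x}. q x y * (min (H (?Z y)) C - min (H (?Z x)) C)) = drift (\<lambda>z. min (H z) C) x"
        by (rule generator_eq_drift[OF x])
      also have "\<dots> \<le> drift H x"
        using lt by (intro drift_mono x rates) auto
      also have "\<dots> \<le> drift V x + \<epsilon> * L"
        unfolding H_def L_def using \<epsilon> by (intro drift_perturb x rates) auto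
      also have "\<dots> \<le> \<kappa> * B + \<epsilon> * L - \<kappa> * V (?Z x)"
        using dr[OF x] by (simp add: algebra_simps)
      finally show "(\<Sum>\<^sub>\<infinity>y\<in>S - {x}. q x y * (min (H (?Z y)) C - min (H (?Z x)) C))
          \<le> \<kappa> * B + \<epsilon> * L - \<kappa> * V (?Z x)" .
    qed simp
    also have "\<dots> = (\<kappa> * B + \<epsilon> * L) * (\<Sum>x\<in>F. pmf p x) - \<kappa> * (\<Sum>x\<in>F. pmf p x * V (?Z x))"
      by (simp add: right_diff_distrib sum_subtractf sum_distrib_left sum_distrib_right mult_ac)
    finally have main: "\<kappa> * (\<Sum>x\<in>F. pmf p x * V (?Z x)) \<le> (\<kappa> * B + \<epsilon> * L) * (\<Sum>x\<in>F. pmf p x)"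
      by simp
    have "(\<Sum>x\<in>A. pmf p x * V (?Z x)) \<le> (\<Sum>x\<in>F. pmf p x * V (?Z x))"
      using AF finF V by (intro sum_mono2) auto
    then have "\<kappa> * (\<Sum>x\<in>A. pmf p x * V (?Z x)) \<le> \<kappa> * (\<Sum>x\<in>F. pmf p x * V (?Z x))"
      using \<kappa> by (intro mult_left_mono) auto
    also note main
    also have "(\<kappa> * B + \<epsilon> * L) * (\<Sum>x\<in>F. pmf p x) \<le> (\<kappa> * B + \<epsilon> * L) * 1"
      using \<kappa> B L \<epsilon> by (intro mult_left_mono prob finF) auto
    finally have "\<kappa> * (\<Sum>x\<in>A. pmf p x * V (?Z x)) \<le> \<kappa> * B + \<epsilon> * L"
      by simp
    then show ?thesis
      using \<kappa> by (simp add: field_simps)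
  qed
  have bound: "(\<Sum>x\<in>A. pmf p x * V (?Z x)) \<le> B" if A: "finite A" "A \<subseteq> S" for A
  proof (cases "A = {}")
    case False
    show ?thesis
    proof (rule field_le_epsilon)
      fix e :: real assume e: "0 < e"
      \<comment> \<open>This value of the perturbation makes its contribution at most
        \<open>e\<close>; the \<open>+ 1\<close> covers \<open>L = 0\<close>.\<close>
      have "(e * \<kappa> / (L + 1)) * (L / \<kappa>) \<le> e"
        using e \<kappa> L by (simp add: field_simps)
      moreover have "0 < e * \<kappa> / (L + 1)"
        using e \<kappa> L by simp
      ultimately show "(\<Sum>x\<in>A. pmf p x * V (?Z x)) \<le> B + e"
        using bound_eps[OF A False, of "e * \<kappa> / (L + 1)"] by linarith
    qed
  qed (simp add: B)
  \<comment> \<open>Fatou's lemma along the finite sets \<open>A k\<close>, which eventually contain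
    each given state, turns the bound on finite sums into one on the integral.\<close>
  define A where "A k = {x \<in> S. in_total (?Z x) \<le> k}" for k
  have "(\<integral>\<^sup>+x. ennreal (V (?Z x)) \<partial>measure_pmf p)
      \<le> (\<integral>\<^sup>+x. liminf (\<lambda>k. ennreal (V (?Z x)) * indicator (A k) x) \<partial>measure_pmf p)"
  proof (intro nn_integral_mono_AE AE_pmfI)
    fix x assume "x \<in> set_pmf p"
    then have "x \<in> S" using pS by auto
    have "\<forall>\<^sub>F k in sequentially. ennreal (V (?Z x)) * indicator (A k) x = ennreal (V (?Z x))"
      using eventually_ge_at_top[of "in_total (?Z x)"] by eventually_elim (use \<open>x \<in> S\<close> in \<open>simp add: A_def\<close>)
    then have "(\<lambda>k. ennreal (V (?Z x)) * indicator (A k) x) \<longlonglongrightarrow> ennreal (V (?Z x))"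
      by (rule tendsto_eventually)
    then show "ennreal (V (?Z x)) \<le> liminf (\<lambda>k. ennreal (V (?Z x)) * indicator (A k) x)"
      by (simp add: lim_imp_Liminf)
  qed
  also have "\<dots> \<le> liminf (\<lambda>k. \<integral>\<^sup>+x. ennreal (V (?Z x)) * indicator (A k) x \<partial>measure_pmf p)"
    by (rule nn_integral_liminf) simp
  also have "\<dots> = liminf (\<lambda>k. ennreal (\<Sum>x\<in>A k. pmf p x * V (?Z x)))"
  proof -
    have "(\<integral>\<^sup>+x. ennreal (V (?Z x)) * indicator (A k) x \<partial>measure_pmf p) =
        ennreal (\<Sum>x\<in>A k. pmf p x * V (?Z x))" for k
    proof -
      have "(\<integral>\<^sup>+x. ennreal (V (?Z x)) * indicator (A k) x \<partial>measure_pmf p) =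
          (\<Sum>x\<in>A k. ennreal (V (?Z x)) * indicator (A k) x * ennreal (pmf p x))"
        using finite_bounded_states by (intro nn_integral_measure_pmf_support) (auto simp: A_def)
      also have "\<dots> = (\<Sum>x\<in>A k. ennreal (pmf p x * V (?Z x)))"
        by (intro sum.cong) (auto simp: ennreal_mult'' V mult.commute)
      also have "\<dots> = ennreal (\<Sum>x\<in>A k. pmf p x * V (?Z x))"
        using V by (intro sum_ennreal) auto
      finally show ?thesis .
    qed
    then show ?thesis by simp
  qed
  also have "\<dots> \<le> liminf (\<lambda>k::nat. ennreal B)"
    using bound finite_bounded_states by (intro Liminf_mono always_eventually allI ennreal_leI) (auto simp: A_def)
  finally show ?thesis
    by (simp add: Liminf_const)
qed

end

section \<open>The exponential Lyapunov function\<close>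

locale critical_queue = queueing_system S q P lam \<mu> \<nu> a r f
  for S :: "'x set" and q :: "'x \<Rightarrow> 'x \<Rightarrow> real" and P :: "real \<Rightarrow> 'x \<Rightarrow> 'x pmf"
    and lam \<mu> \<nu> :: "'i::finite \<Rightarrow> real" and a :: real and r :: nat
    and f :: "'x \<Rightarrow> ('i \<Rightarrow> nat) \<times> ('i \<Rightarrow> nat)" +
  assumes lam_pos: "\<And>l. 0 < lam l" and mu_pos: "\<And>l. 0 < \<mu> l" and nu_nonneg: "\<And>l. 0 \<le> \<nu> l"
    and spare: "0 \<le> a" and load: "(\<Sum>l\<in>UNIV. lam l / \<mu> l) = 1" and r_pos: "1 \<le> r"
begin

definition scaled_size :: "('i \<Rightarrow> nat) \<Rightarrow> 'i \<Rightarrow> real" where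
  "scaled_size z l = (real (z l) - lam l / \<mu> l * real r) / sqrt (real r)"

abbreviation sz :: "'x \<Rightarrow> 'i \<Rightarrow> real" where
  "sz x l \<equiv> scaled_size (in_system f x) l"

text \<open>The scaled size of one customer. Total rates of order \<open>r\<close> times squared
  jumps \<open>\<delta>^2\<close> give variances of order one.\<close>

definition \<delta> :: real where
  "\<delta> = 1 / sqrt (real r)"

lemma \<delta>_pos: "0 < \<delta>" and \<delta>_le_1: "\<delta> \<le> 1" and \<delta>_sq: "real r * \<delta>\<^sup>2 = 1"
  using r_pos by (auto simp: \<delta>_def power_divide field_simps)

lemma scaled_size_eq: "scaled_size z l = \<delta> * real (z l) - lam l / \<mu> l * (\<delta> * real r)"
  by (simp add: scaled_size_def \<delta>_def diff_divide_distrib)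

lemma scaled_class_eq: "scaled_class lam \<mu> r f x l = sz x l"
  by (simp add: scaled_size_def scaled_class_def)

text \<open>The weights \<open>1 / \<mu> l\<close> give every class the same restoring rate, which
  makes the class drifts comparable with the sum of the queues.\<close>

definition lyap :: "real \<Rightarrow> real \<Rightarrow> ('i \<Rightarrow> nat) \<Rightarrow> real" where
  "lyap \<sigma> t z = exp (t * (\<Sum>l\<in>UNIV. smooth_pos (\<sigma> * scaled_size z l) / \<mu> l))"

definition class_drift :: "real \<Rightarrow> real \<Rightarrow> 'x \<Rightarrow> 'i \<Rightarrow> real" where
  "class_drift \<sigma> t x l =
     lam l * real r * (exp (t / \<mu> l * (smooth_pos (\<sigma> * (sz x l + \<delta>)) - smooth_pos (\<sigma> * sz x l))) - 1)
     + departure x l * (exp (t / \<mu> l * (smooth_pos (\<sigma> * (sz x l - \<delta>)) - smooth_pos (\<sigma> * sz x l))) - 1)"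

text \<open>The exponential of a sum factorizes: a jump in class \<open>l\<close> multiplies
  \<open>lyap\<close> by a factor depending on coordinate \<open>l\<close> alone.\<close>

lemma drift_lyap:
  assumes x: "x \<in> S"
  shows "drift (lyap \<sigma> t) x = lyap \<sigma> t (in_system f x) * (\<Sum>l\<in>UNIV. class_drift \<sigma> t x l)"
proof -
  let ?z = "in_system f x"
  have upd: "lyap \<sigma> t (z(l := k)) =
      lyap \<sigma> t z * exp (t / \<mu> l * (smooth_pos (\<sigma> * (scaled_size z l + \<delta> * (real k - real (z l)))) - smooth_pos (\<sigma> * scaled_size z l)))"
    for z l k
  proof -
    have "scaled_size (z(l := k)) l = scaled_size z l + \<delta> * (real k - real (z l))"
      by (simp add: scaled_size_eq algebra_simps)
    moreover have "scaled_size (z(l := k)) i = scaled_size z i" if "i \<noteq> l" for i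
      using that by (simp add: scaled_size_def)
    ultimately have sum_eq: "(\<Sum>i\<in>UNIV. smooth_pos (\<sigma> * scaled_size (z(l := k)) i) / \<mu> i) =
        (\<Sum>i\<in>UNIV. smooth_pos (\<sigma> * scaled_size z i) / \<mu> i)
        + (smooth_pos (\<sigma> * (scaled_size z l + \<delta> * (real k - real (z l)))) - smooth_pos (\<sigma> * scaled_size z l)) / \<mu> l"
      by (simp add: sum.remove[of UNIV l] diff_divide_distrib)
    show ?thesis
      unfolding lyap_def sum_eq by (simp add: exp_add[symmetric] distrib_left)
  qed
  have dn: "departure x l * (lyap \<sigma> t (?z(l := ?z l - 1)) - lyap \<sigma> t ?z) =
      lyap \<sigma> t ?z * (departure x l * (exp (t / \<mu> l * (smooth_pos (\<sigma> * (sz x l - \<delta>)) - smooth_pos (\<sigma> * sz x l))) - 1))" for l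
  \<comment> \<open>For an empty class the truncated vector stays put while
    \<open>class_drift\<close> moves by \<open>- \<delta>\<close>; both terms vanish with the
    departure rate.\<close>
  proof (cases "?z l = 0")
    case True
    then show ?thesis using departure_empty[OF x True] by simp
  next
    case False
    then have "real (?z l - 1) - real (?z l) = -1" by simp
    then show ?thesis unfolding upd by (simp add: algebra_simps)
  qed
  have up: "lyap \<sigma> t (?z(l := ?z l + 1)) =
      lyap \<sigma> t ?z * exp (t / \<mu> l * (smooth_pos (\<sigma> * (sz x l + \<delta>)) - smooth_pos (\<sigma> * sz x l)))" for l
    unfolding upd by simp
  show ?thesis
    unfolding drift_def Let_def class_drift_def dn up sum_distrib_left
    by (intro sum.cong) (simp_all add: algebra_simps)
qed

section \<open>Fluid drift and the size of the queues\<close>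

definition scaled_queue :: "'x \<Rightarrow> 'i \<Rightarrow> real" where
  "scaled_queue x l = \<delta> * real (in_queue f x l)"

lemma scaled_queue_nonneg: "0 \<le> scaled_queue x l"
  using \<delta>_pos by (simp add: scaled_queue_def)

lemma in_system_eq: "x \<in> S \<Longrightarrow> real (in_system f x l) = real (in_service f x l) + real (in_queue f x l)"
  using service_le[of x l] by (simp add: in_queue_def)

lemma departure_le:
  assumes "x \<in> S" "\<mu> l \<le> M" "\<nu> l \<le> M"
  shows "departure x l \<le> M * real (in_system f x l)"
  using assms by (simp add: departure_def in_system_eq distrib_left add_mono mult_right_mono)

lemma departure_nonneg: "0 \<le> departure x l"
  using mu_pos[of l] nu_nonneg[of l] by (simp add: departure_def)

lemma fluid_drift:
  assumes x: "x \<in> S"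
  shows "(lam l * real r - departure x l) * \<delta> / \<mu> l = - sz x l + (1 - \<nu> l / \<mu> l) * scaled_queue x l"
  using mu_pos[of l] in_system_eq[OF x, of l]
  by (simp add: scaled_size_eq departure_def scaled_queue_def field_simps)

lemma sum_scaled_size: "(\<Sum>l\<in>UNIV. sz x l) = \<delta> * (real (\<Sum>l\<in>UNIV. in_system f x l) - real r)"
proof -
  have "(\<Sum>l\<in>UNIV. sz x l) = \<delta> * real (\<Sum>l\<in>UNIV. in_system f x l) - (\<Sum>l\<in>UNIV. lam l / \<mu> l) * (\<delta> * real r)"
    by (simp add: scaled_size_eq sum_subtractf sum_distrib_left sum_distrib_right)
  then show ?thesis
    by (simp add: load algebra_simps)
qed

text \<open>By non-idling the total queue is the excess of customers over servers. There are at
  least \<open>r\<close> servers, and critical load makes \<open>r\<close> the centre of the scaled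
  total. Finally, the positive part of a sum is at most the sum of the positive parts.\<close>

lemma sum_scaled_queue_le:
  assumes x: "x \<in> S"
  shows "(\<Sum>l\<in>UNIV. scaled_queue x l) \<le> (\<Sum>l\<in>UNIV. max (sz x l) 0)"
proof -
  let ?T = "\<Sum>l\<in>UNIV. in_system f x l"
  have "real r + a * sqrt (real r) \<ge> real r"
    using spare by simp
  then have N: "r \<le> num_servers a r"
    unfolding num_servers_def by (simp add: le_nat_iff) linarith
  have "(\<Sum>l\<in>UNIV. in_queue f x l) + min (num_servers a r) ?T = ?T"
    unfolding non_idling[OF x, symmetric] sum.distrib[symmetric]
    using service_le[OF x] by (intro sum.cong) (auto simp: in_queue_def)
  then have Q: "real (\<Sum>l\<in>UNIV. in_queue f x l) \<le> max (real ?T - real r) 0"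
    using N by linarith
  have "(\<Sum>l\<in>UNIV. scaled_queue x l) = \<delta> * real (\<Sum>l\<in>UNIV. in_queue f x l)"
    by (simp add: scaled_queue_def sum_distrib_left)
  also have "\<dots> \<le> \<delta> * max (real ?T - real r) 0"
    using Q \<delta>_pos by (intro mult_left_mono) auto
  also have "\<dots> = max (\<Sum>l\<in>UNIV. sz x l) 0"
    using \<delta>_pos by (simp add: sum_scaled_size max_mult_distrib_left)
  also have "\<dots> \<le> (\<Sum>l\<in>UNIV. max (sz x l) 0)"
    by (auto intro!: sum_mono sum_nonneg)
  finally show ?thesis .
qed

text \<open>Arrivals and departures move the coordinate by opposite steps, so their first-order
  terms combine into the net rate of \<open>fluid_drift\<close>, while their second-order terms add
  up.\<close>

lemma class_drift_le:
  assumes x: "x \<in> S" and \<sigma>: "\<sigma> = 1 \<or> \<sigma> = -1" and t: "0 \<le> t" "t * \<delta> \<le> \<mu> l"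
  shows "class_drift \<sigma> t x l \<le>
    t * (\<sigma> * ramp (\<sigma> * sz x l) * (- sz x l + (1 - \<nu> l / \<mu> l) * scaled_queue x l))
    + (lam l * real r + departure x l) * \<delta>\<^sup>2 * (t / \<mu> l + (t / \<mu> l)\<^sup>2)"
proof -
  define s where "s = t / \<mu> l"
  define \<kappa> where "\<kappa> = s + s\<^sup>2"
  define u where "u = \<sigma> * sz x l"
  have s: "0 \<le> s" "s * \<delta> \<le> 1"
    using t mu_pos[of l] by (auto simp: s_def field_simps)
  have \<sigma>2: "\<bar>\<sigma> * d\<bar> = \<bar>d\<bar>" "(\<sigma> * d)\<^sup>2 = d\<^sup>2" for d
    using \<sigma> by auto
  have incr: "exp (s * (smooth_pos (\<sigma> * (sz x l + d)) - smooth_pos u)) - 1 \<le> s * ramp u * (\<sigma> * d) + \<kappa> * \<delta>\<^sup>2"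
    if "\<bar>d\<bar> = \<delta>" for d
  proof -
    have "d\<^sup>2 = \<delta>\<^sup>2"
      using that by (metis power2_abs)
    then show ?thesis
      using exp_smooth_pos_increment[of s "u + \<sigma> * d" u] s \<sigma>2[of d] that
      by (simp add: u_def \<kappa>_def distrib_left)
  qed
  have "class_drift \<sigma> t x l \<le> lam l * real r * (s * ramp u * (\<sigma> * \<delta>) + \<kappa> * \<delta>\<^sup>2)
      + departure x l * (s * ramp u * (\<sigma> * (- \<delta>)) + \<kappa> * \<delta>\<^sup>2)"
    unfolding class_drift_def s_def[symmetric] u_def[symmetric]
    using incr[of \<delta>] incr[of "- \<delta>"] \<delta>_pos lam_pos[of l] departure_nonneg[of x l]
    by (intro add_mono mult_left_mono) auto
  also have "\<dots> = t * (\<sigma> * ramp u * ((lam l * real r - departure x l) * \<delta> / \<mu> l))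
      + (lam l * real r + departure x l) * \<delta>\<^sup>2 * \<kappa>"
    by (simp add: s_def algebra_simps diff_divide_distrib)
  finally show ?thesis
    unfolding fluid_drift[OF x] u_def \<kappa>_def s_def .
qed

end

text \<open>Per class, the summand 1 pays for the loss in \<open>ramp_mult_ge\<close>, and the rest
  is the variance term of \<open>class_drift_bound\<close> with \<open>R = 1\<close>. The constant
  is uniform in \<open>r\<close> and \<open>t\<close>.\<close>

definition drift_const :: "nat \<Rightarrow> real \<Rightarrow> real \<Rightarrow> real" where
  "drift_const n m M = real n * (1 + 3 * M * (1 / m + 1 / m\<^sup>2))"

text \<open>The first summand pays for comparing the excess with \<open>lyap\<close>; the second
  bounds the exponent of \<open>lyap_moment\<close> at parameter \<open>t * M\<close>.\<close>

definition moment_const :: "nat \<Rightarrow> real \<Rightarrow> real \<Rightarrow> real \<Rightarrow> real" where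
  "moment_const n m M \<eta> = real n + 2 * drift_const n m M * M\<^sup>2 / (\<eta> * m)"

lemma drift_const_pos: "0 < n \<Longrightarrow> 0 < m \<Longrightarrow> 0 \<le> M \<Longrightarrow> 0 < drift_const n m M"
  by (auto simp: drift_const_def intro!: mult_pos_pos add_pos_nonneg)

lemma drift_const_mult:
  "drift_const n m M * s = real n * s + 3 * (real n * M * ((1 / m + 1 / m\<^sup>2) * s))"
proof -
  define c where "c = 1 / m + 1 / m\<^sup>2"
  show ?thesis
    unfolding drift_const_def c_def[symmetric] by (simp add: algebra_simps)
qed

lemma moment_const_nonneg: "0 < n \<Longrightarrow> 0 < m \<Longrightarrow> 0 \<le> M \<Longrightarrow> 0 < \<eta> \<Longrightarrow> 0 \<le> moment_const n m M \<eta>"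
  using drift_const_pos[of n m M] by (simp add: moment_const_def)

section \<open>Drift and moment bounds uniform in the system size\<close>

context critical_queue
begin

definition excess :: "real \<Rightarrow> 'x \<Rightarrow> real" where
  "excess \<sigma> x = (\<Sum>l\<in>UNIV. max (\<sigma> * sz x l) 0)"

lemma excess_nonneg: "0 \<le> excess \<sigma> x"
  by (auto simp: excess_def intro: sum_nonneg)

lemma load_le_1: "lam l / \<mu> l \<le> 1"
  using member_le_sum[of l UNIV "\<lambda>l. lam l / \<mu> l"] lam_pos mu_pos load by (simp add: less_imp_le)

context
  fixes m M :: real
  assumes m: "0 < m" "m \<le> 1" and M: "1 \<le> M"
    and mu_bounds: "\<And>l. m \<le> \<mu> l" "\<And>l. \<mu> l \<le> M"
    and lam_le: "\<And>l. lam l \<le> M" and nu_le: "\<And>l. \<nu> l \<le> M"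
begin

lemma variance_coeff_le:
  assumes "0 \<le> t"
  shows "t / \<mu> l + (t / \<mu> l)\<^sup>2 \<le> (1 / m + 1 / m\<^sup>2) * (t + t\<^sup>2)"
proof -
  have "t / \<mu> l \<le> t / m"
    using assms m mu_bounds by (intro divide_left_mono) (auto intro: mult_pos_pos mu_pos)
  moreover from this have "(t / \<mu> l)\<^sup>2 \<le> (t / m)\<^sup>2"
    using assms mu_pos[of l] by (intro power_mono) auto
  moreover have "0 \<le> t / m\<^sup>2" "0 \<le> t\<^sup>2 / m"
    using assms m by auto
  ultimately show ?thesis
    by (simp add: power_divide algebra_simps add_divide_distrib)
qed

text \<open>The departure rate is at most \<open>M\<close> times the class size, and
  \<open>\<delta>^2\<close> times that size is the load plus \<open>\<delta> * sz x l\<close>. So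
  \<open>R\<close> measures how far a large class inflates the variance.\<close>

lemma class_drift_bound:
  assumes x: "x \<in> S" and \<sigma>: "\<sigma> = 1 \<or> \<sigma> = -1" and t: "0 \<le> t" "t * \<delta> \<le> m"
    and R: "\<delta> * sz x l \<le> R" "0 \<le> R"
  shows "class_drift \<sigma> t x l \<le>
    t * (\<sigma> * ramp (\<sigma> * sz x l) * (- sz x l + (1 - \<nu> l / \<mu> l) * scaled_queue x l))
    + M * (2 + R) * ((1 / m + 1 / m\<^sup>2) * (t + t\<^sup>2))"
proof -
  have "\<delta>\<^sup>2 * real (in_system f x l) = \<delta> * sz x l + lam l / \<mu> l * (real r * \<delta>\<^sup>2)"
    by (simp add: scaled_size_eq power2_eq_square algebra_simps)
  then have Z: "\<delta>\<^sup>2 * real (in_system f x l) \<le> R + 1"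
    using load_le_1[of l] R by (simp add: \<delta>_sq)
  have "departure x l * \<delta>\<^sup>2 \<le> M * real (in_system f x l) * \<delta>\<^sup>2"
    using departure_le[OF x mu_bounds(2) nu_le] by (intro mult_right_mono) auto
  also have "\<dots> = M * (\<delta>\<^sup>2 * real (in_system f x l))"
    by simp
  also have "\<dots> \<le> M * (R + 1)"
    using Z M by (intro mult_left_mono) auto
  finally have "departure x l * \<delta>\<^sup>2 \<le> M * (R + 1)" .
  moreover have "lam l * real r * \<delta>\<^sup>2 \<le> M"
    using lam_le[of l] \<delta>_sq by (simp add: mult.assoc)
  ultimately have "(lam l * real r + departure x l) * \<delta>\<^sup>2 \<le> M * (2 + R)"
    by (simp add: algebra_simps)
  then have "(lam l * real r + departure x l) * \<delta>\<^sup>2 * (t / \<mu> l + (t / \<mu> l)\<^sup>2)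
      \<le> M * (2 + R) * ((1 / m + 1 / m\<^sup>2) * (t + t\<^sup>2))"
    using t M R mu_pos[of l] variance_coeff_le[OF t(1), of l] by (intro mult_mono[of _ "M * (2 + R)"]) auto
  moreover have "t * \<delta> \<le> \<mu> l"
    using t mu_bounds(1)[of l] by linarith
  ultimately show ?thesis
    using class_drift_le[OF x \<sigma> t(1)] by fastforce
qed

lemma drift_const_card_pos: "0 < drift_const CARD('i) m M"
  using m M by (intro drift_const_pos) auto

lemma total_drift_neg:
  assumes x: "x \<in> S" and t: "0 \<le> t" "t * \<delta> \<le> m" and \<nu>: "\<And>l. \<nu> l \<le> \<mu> l"
  shows "(\<Sum>l\<in>UNIV. class_drift (-1) t x l) \<le> - t * excess (-1) x + drift_const CARD('i) m M * (t + t\<^sup>2)"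
proof -
  define b where "b = (1 / m + 1 / m\<^sup>2) * (t + t\<^sup>2)"
  have b: "0 \<le> b"
    using m t by (auto simp: b_def)
  have "class_drift (-1) t x l \<le> t * (1 - max (-1 * sz x l) 0) + M * 3 * b" for l
  \<comment> \<open>From \<open>\<delta>\<close> upwards, neither jump reaches the region where
    \<open>smooth_pos (- _)\<close> is nonzero. Below it \<open>R = 1\<close> suffices, so large
    classes never inflate the variance here.\<close>
  proof (cases "\<delta> \<le> sz x l")
    case True
    have zero: "smooth_pos y = 0" if "y \<le> 0" for y
      using smooth_pos_le[of y] smooth_pos_nonneg[of y] that by simp
    have "class_drift (-1) t x l = 0"
      using True \<delta>_pos by (simp add: class_drift_def zero)
    then show ?thesis
      using True \<delta>_pos t b M by simp
  next
    case False
    define u where "u = -1 * sz x l"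
    have "\<delta> * sz x l \<le> 1"
    proof (cases "0 \<le> sz x l")
      case True
      then show ?thesis
        using False \<delta>_pos \<delta>_le_1 mult_mono[of \<delta> 1 "sz x l" 1] by auto
    next
      case False
      then show ?thesis
        using \<delta>_pos mult_pos_neg[of \<delta> "sz x l"] by linarith
    qed
    then have "class_drift (-1) t x l \<le>
        t * (-1 * ramp u * (- sz x l + (1 - \<nu> l / \<mu> l) * scaled_queue x l)) + M * (2 + 1) * b"
      unfolding u_def b_def by (intro class_drift_bound x t) auto
    also have "-1 * ramp u * (- sz x l + (1 - \<nu> l / \<mu> l) * scaled_queue x l) \<le> 1 - max u 0"
    proof -
      \<comment> \<open>With \<open>\<nu> l \<le> \<mu> l\<close> the queue pushes a negative
        coordinate back up, so its term may be dropped.\<close>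
      have "0 \<le> ramp u * ((1 - \<nu> l / \<mu> l) * scaled_queue x l)"
        using \<nu>[of l] mu_pos[of l] by (intro mult_nonneg_nonneg ramp_nonneg scaled_queue_nonneg) auto
      then show ?thesis
        using ramp_mult_ge[of u] by (simp add: u_def algebra_simps)
    qed
    finally show ?thesis
      using t by (simp add: u_def mult_left_mono)
  qed
  then have "(\<Sum>l\<in>UNIV. class_drift (-1) t x l) \<le>
      (\<Sum>l\<in>UNIV. t * (1 - max (-1 * sz x l) 0) + M * 3 * b)"
    by (intro sum_mono) blast
  also have "\<dots> = - t * excess (-1) x + real CARD('i) * (t + M * 3 * b)"
    by (simp add: excess_def sum.distrib sum_subtractf sum_distrib_left right_diff_distrib sum_negf algebra_simps)
  also have "real CARD('i) * (t + M * 3 * b) \<le> drift_const CARD('i) m M * (t + t\<^sup>2)"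
    unfolding drift_const_mult b_def[symmetric] by (simp add: algebra_simps)
  finally show ?thesis by simp
qed

text \<open>The queues cancel at most a fraction \<open>1 - \<epsilon>\<close> of the restoring
  drift. Departures from large classes make the variance grow with the excess, but with an extra
  factor \<open>\<delta>\<close>; the hypothesis \<open>small\<close> lets half of the remaining
  \<open>\<epsilon>\<close> absorb it.\<close>

lemma total_drift_pos:
  assumes x: "x \<in> S" and t: "0 \<le> t" "t * \<delta> \<le> m"
    and \<epsilon>: "0 < \<epsilon>" "\<epsilon> \<le> 1" "\<And>l. \<epsilon> * \<mu> l \<le> \<nu> l"
    and small: "drift_const CARD('i) m M * (1 + t) * \<delta> \<le> \<epsilon> / 2"
  shows "(\<Sum>l\<in>UNIV. class_drift 1 t x l) \<le> - t * (\<epsilon> / 2) * excess 1 x + drift_const CARD('i) m M * (t + t\<^sup>2)"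
proof -
  define b where "b = (1 / m + 1 / m\<^sup>2) * (t + t\<^sup>2)"
  define X where "X = excess 1 x"
  let ?n = "real CARD('i)"
  have b: "0 \<le> b"
    using m t by (auto simp: b_def)
  have X: "0 \<le> X"
    by (simp add: X_def excess_nonneg)
  have "class_drift 1 t x l \<le> t * (1 - max (1 * sz x l) 0) + t * (1 - \<epsilon>) * scaled_queue x l + M * (2 + \<delta> * X) * b"
    for l
  proof -
    have "sz x l \<le> X"
      unfolding X_def excess_def
      using member_le_sum[of l UNIV "\<lambda>l. max (1 * sz x l) 0"] by simp
    then have "\<delta> * sz x l \<le> \<delta> * X"
      using \<delta>_pos by simp
    then have "class_drift 1 t x l \<le>
        t * (1 * ramp (1 * sz x l) * (- sz x l + (1 - \<nu> l / \<mu> l) * scaled_queue x l)) + M * (2 + \<delta> * X) * b"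
      unfolding b_def using X \<delta>_pos by (intro class_drift_bound x t) auto
    moreover have "1 * ramp (1 * sz x l) * (- sz x l + (1 - \<nu> l / \<mu> l) * scaled_queue x l)
        \<le> 1 - max (1 * sz x l) 0 + (1 - \<epsilon>) * scaled_queue x l"
    proof -
      have "(1 - \<nu> l / \<mu> l) * scaled_queue x l \<le> (1 - \<epsilon>) * scaled_queue x l"
        using \<epsilon>(3)[of l] mu_pos[of l] by (intro mult_right_mono scaled_queue_nonneg) (simp add: field_simps)
      then have "ramp (sz x l) * ((1 - \<nu> l / \<mu> l) * scaled_queue x l) \<le>
          ramp (sz x l) * ((1 - \<epsilon>) * scaled_queue x l)"
        by (intro mult_left_mono ramp_nonneg)
      also have "\<dots> \<le> 1 * ((1 - \<epsilon>) * scaled_queue x l)"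
        using \<epsilon> by (intro mult_right_mono ramp_le_1 mult_nonneg_nonneg scaled_queue_nonneg) auto
      finally show ?thesis
        using ramp_mult_ge[of "sz x l"] unfolding distrib_left mult_1_left by linarith
    qed
    from mult_left_mono[OF this t(1)] show ?thesis
      using calculation by (simp add: algebra_simps)
  qed
  then have "(\<Sum>l\<in>UNIV. class_drift 1 t x l) \<le>
      (\<Sum>l\<in>UNIV. t * (1 - max (1 * sz x l) 0) + t * (1 - \<epsilon>) * scaled_queue x l + M * (2 + \<delta> * X) * b)"
    by (intro sum_mono) blast
  also have "\<dots> = t * (?n - X) + t * (1 - \<epsilon>) * (\<Sum>l\<in>UNIV. scaled_queue x l) + ?n * (M * (2 + \<delta> * X) * b)"
    by (simp add: X_def excess_def sum.distrib sum_subtractf sum_distrib_left right_diff_distrib)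
  also have "(\<Sum>l\<in>UNIV. scaled_queue x l) \<le> X"
    using sum_scaled_queue_le[OF x] by (simp add: X_def excess_def)
  finally have "(\<Sum>l\<in>UNIV. class_drift 1 t x l) \<le>
      t * (?n - X) + t * (1 - \<epsilon>) * X + ?n * (M * (2 + \<delta> * X) * b)"
    using t \<epsilon> by (simp add: mult_left_mono)
  also have "\<dots> = - t * \<epsilon> * X + (t * ?n + 2 * ?n * M * b) + ?n * M * b * \<delta> * X"
    by (simp add: algebra_simps)
  also have "t * ?n + 2 * ?n * M * b \<le> drift_const CARD('i) m M * (t + t\<^sup>2)"
  proof -
    have "drift_const CARD('i) m M * (t + t\<^sup>2) = t * ?n + 2 * ?n * M * b + (?n * t\<^sup>2 + ?n * M * b)"
      unfolding drift_const_mult b_def[symmetric] by (simp add: algebra_simps)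
    moreover have "0 \<le> ?n * t\<^sup>2 + ?n * M * b"
      using b M by simp
    ultimately show ?thesis by linarith
  qed
  \<comment> \<open>The growing part of the variance, paid for by \<open>small\<close>.\<close>
  also have "?n * M * b * \<delta> * X \<le> t * (\<epsilon> / 2) * X"
  proof -
    have "drift_const CARD('i) m M * (t + t\<^sup>2) = ?n * M * b + (?n * (t + t\<^sup>2) + 2 * ?n * M * b)"
      unfolding drift_const_mult b_def[symmetric] by (simp add: algebra_simps)
    moreover have "0 \<le> ?n * (t + t\<^sup>2) + 2 * ?n * M * b"
      using b M t by simp
    ultimately have "?n * M * b \<le> drift_const CARD('i) m M * (t + t\<^sup>2)"
      by linarith
    then have "?n * M * b * \<delta> \<le> drift_const CARD('i) m M * (t + t\<^sup>2) * \<delta>"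
      using \<delta>_pos by (intro mult_right_mono) auto
    also have "\<dots> = t * (drift_const CARD('i) m M * (1 + t) * \<delta>)"
      by (simp add: power2_eq_square algebra_simps)
    also have "\<dots> \<le> t * (\<epsilon> / 2)"
      using small t by (intro mult_left_mono) auto
    finally show ?thesis
      using X by (intro mult_right_mono)
  qed
  finally show ?thesis
    by (simp add: X_def algebra_simps)
qed

text \<open>Either the drift factor is at most \<open>- \<kappa>\<close>, or the excess is at most
  \<open>2 * \<kappa> / (t * \<eta>)\<close> and hence \<open>lyap\<close> is at most
  \<open>exp K\<close>. In the second case the drift factor is still at most
  \<open>\<kappa>\<close>, and the 2 in \<open>2 * exp K\<close> compensates for its sign.\<close>

lemma lyap_moment:
  assumes p: "stationary_distribution S P p" and t: "0 < t" and \<eta>: "0 < \<eta>"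
    and dr: "\<And>x. x \<in> S \<Longrightarrow>
      (\<Sum>l\<in>UNIV. class_drift \<sigma> t x l) \<le> - t * \<eta> * excess \<sigma> x + drift_const CARD('i) m M * (t + t\<^sup>2)"
  shows "(\<integral>\<^sup>+x. ennreal (lyap \<sigma> t (in_system f x)) \<partial>measure_pmf p)
    \<le> ennreal (2 * exp (2 * drift_const CARD('i) m M * (t + t\<^sup>2) / (\<eta> * m)))"
proof -
  define \<kappa> where "\<kappa> = drift_const CARD('i) m M * (t + t\<^sup>2)"
  define K where "K = 2 * \<kappa> / (\<eta> * m)"
  have \<kappa>: "0 < \<kappa>"
    unfolding \<kappa>_def using drift_const_card_pos t by (intro mult_pos_pos add_pos_pos) auto
  have "(\<integral>\<^sup>+x. ennreal (lyap \<sigma> t (in_system f x)) \<partial>measure_pmf p) \<le> ennreal (2 * exp K)"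
  proof (rule foster_lyapunov[OF p])
    fix x assume x: "x \<in> S"
    define v where "v = lyap \<sigma> t (in_system f x)"
    define D where "D = (\<Sum>l\<in>UNIV. class_drift \<sigma> t x l)"
    have v: "0 < v"
      by (simp add: v_def lyap_def)
    have D: "D \<le> - t * \<eta> * excess \<sigma> x + \<kappa>"
      using dr[OF x] by (simp add: D_def \<kappa>_def)
    have "v * D \<le> \<kappa> * (2 * exp K - v)"
    proof (cases "D \<le> - \<kappa>")
      case True
      then have "v * D \<le> v * (- \<kappa>)"
        using v by (intro mult_left_mono) auto
      moreover have "0 \<le> \<kappa> * (2 * exp K)"
        using \<kappa> by simp
      ultimately show ?thesis
        by (simp add: algebra_simps)
    next
      case False
      then have ex: "t * \<eta> * excess \<sigma> x \<le> 2 * \<kappa>"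
        using D by linarith
      have "(\<Sum>l\<in>UNIV. smooth_pos (\<sigma> * sz x l) / \<mu> l) \<le> (\<Sum>l\<in>UNIV. max (\<sigma> * sz x l) 0 / m)"
        using smooth_pos_le smooth_pos_nonneg mu_bounds m by (intro sum_mono frac_le) auto
      also have "\<dots> = excess \<sigma> x / m"
        by (simp add: excess_def sum_divide_distrib)
      finally have "t * (\<Sum>l\<in>UNIV. smooth_pos (\<sigma> * sz x l) / \<mu> l) \<le> t * (excess \<sigma> x / m)"
        using t by (intro mult_left_mono) auto
      also have "\<dots> = (t * \<eta> * excess \<sigma> x) / (\<eta> * m)"
        using \<eta> by simp
      also have "\<dots> \<le> K"
        unfolding K_def using ex \<eta> m by (intro divide_right_mono) auto
      finally have "v \<le> exp K"
        by (simp add: v_def lyap_def)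
      moreover have "0 \<le> t * \<eta> * excess \<sigma> x"
        using t \<eta> excess_nonneg[of \<sigma> x] by simp
      then have "D \<le> \<kappa>"
        using D by simp
      then have "v * D \<le> v * \<kappa>"
        using v by (intro mult_left_mono) auto
      moreover have "\<kappa> * v \<le> \<kappa> * (2 * exp K - v)"
        using calculation(1) \<kappa> by (intro mult_left_mono) auto
      ultimately show ?thesis
        by (simp add: mult.commute)
    qed
    then show "drift (lyap \<sigma> t) x \<le> \<kappa> * (2 * exp K - lyap \<sigma> t (in_system f x))"
      unfolding drift_lyap[OF x] v_def D_def .
  qed (use lam_pos mu_pos nu_nonneg \<kappa> in \<open>auto simp: less_imp_le lyap_def\<close>)
  then show ?thesis
    by (simp add: K_def \<kappa>_def mult.assoc)
qed

text \<open>The Lyapunov parameter is \<open>t * M\<close> because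
  \<open>M / \<mu> l \<ge> 1\<close> undoes the weights. Replacing the positive part by
  \<open>smooth_pos\<close> is charged one unit per class, whence the factor
  \<open>exp (t * n)\<close> with \<open>n\<close> the number of classes.\<close>

lemma excess_moment:
  assumes p: "stationary_distribution S P p" and t: "0 < t" and \<eta>: "0 < \<eta>"
    and dr: "\<And>x. x \<in> S \<Longrightarrow>
      (\<Sum>l\<in>UNIV. class_drift \<sigma> (t * M) x l)
        \<le> - (t * M) * \<eta> * excess \<sigma> x + drift_const CARD('i) m M * (t * M + (t * M)\<^sup>2)"
  shows "(\<integral>\<^sup>+x. ennreal (exp (t * excess \<sigma> x)) \<partial>measure_pmf p)
    \<le> ennreal (2 * exp (moment_const CARD('i) m M \<eta> * (t + t\<^sup>2)))"
proof -
  let ?n = "real CARD('i)" and ?s = "t * M"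
  have s: "0 < ?s"
    using t M by simp
  have "exp (t * excess \<sigma> x) \<le> exp (t * ?n) * lyap \<sigma> ?s (in_system f x)" for x
  proof -
    have "max (\<sigma> * sz x l) 0 - 1 \<le> M * (smooth_pos (\<sigma> * sz x l) / \<mu> l)" for l
    proof -
      have "smooth_pos (\<sigma> * sz x l) * \<mu> l \<le> smooth_pos (\<sigma> * sz x l) * M"
        using mu_bounds(2)[of l] smooth_pos_nonneg by (intro mult_left_mono) auto
      then have "smooth_pos (\<sigma> * sz x l) \<le> M * (smooth_pos (\<sigma> * sz x l) / \<mu> l)"
        using mu_pos[of l] by (simp add: field_simps)
      then show ?thesis
        using smooth_pos_ge[of "\<sigma> * sz x l"] by linarith
    qed
    then have "(\<Sum>l\<in>UNIV. max (\<sigma> * sz x l) 0 - 1) \<le> (\<Sum>l\<in>UNIV. M * (smooth_pos (\<sigma> * sz x l) / \<mu> l))"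
      by (intro sum_mono) blast
    then have "excess \<sigma> x - ?n \<le> M * (\<Sum>l\<in>UNIV. smooth_pos (\<sigma> * sz x l) / \<mu> l)"
      by (simp add: excess_def sum_subtractf sum_distrib_left)
    then have "t * (excess \<sigma> x - ?n) \<le> t * (M * (\<Sum>l\<in>UNIV. smooth_pos (\<sigma> * sz x l) / \<mu> l))"
      using t by (intro mult_left_mono) auto
    then show ?thesis
      by (simp add: lyap_def exp_add[symmetric] algebra_simps)
  qed
  then have "(\<integral>\<^sup>+x. ennreal (exp (t * excess \<sigma> x)) \<partial>measure_pmf p)
      \<le> (\<integral>\<^sup>+x. ennreal (exp (t * ?n)) * ennreal (lyap \<sigma> ?s (in_system f x)) \<partial>measure_pmf p)"
    by (intro nn_integral_mono) (simp add: ennreal_mult'[symmetric] ennreal_leI)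
  also have "\<dots> = ennreal (exp (t * ?n)) * (\<integral>\<^sup>+x. ennreal (lyap \<sigma> ?s (in_system f x)) \<partial>measure_pmf p)"
    by (rule nn_integral_cmult) simp
  also have "\<dots> \<le> ennreal (exp (t * ?n)) * ennreal (2 * exp (2 * drift_const CARD('i) m M * (?s + ?s\<^sup>2) / (\<eta> * m)))"
    by (intro mult_left_mono lyap_moment[OF p s \<eta>] dr) auto
  also have "\<dots> = ennreal (2 * exp (t * ?n + 2 * drift_const CARD('i) m M * (?s + ?s\<^sup>2) / (\<eta> * m)))"
    by (simp add: ennreal_mult'[symmetric] exp_add)
  also have "\<dots> \<le> ennreal (2 * exp (moment_const CARD('i) m M \<eta> * (t + t\<^sup>2)))"
  proof (intro ennreal_leI mult_left_mono, unfold exp_le_cancel_iff)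
    have "M * 1 \<le> M * M"
      using M by (intro mult_left_mono) auto
    then have "t * M \<le> t * M\<^sup>2"
      using t by (intro mult_left_mono) (auto simp: power2_eq_square)
    then have "?s + ?s\<^sup>2 \<le> M\<^sup>2 * (t + t\<^sup>2)"
      by (simp add: power_mult_distrib algebra_simps)
    then have "2 * drift_const CARD('i) m M * (?s + ?s\<^sup>2) / (\<eta> * m) \<le> 2 * drift_const CARD('i) m M * (M\<^sup>2 * (t + t\<^sup>2)) / (\<eta> * m)"
      using drift_const_card_pos \<eta> m by (intro divide_right_mono mult_left_mono) auto
    moreover have "t * ?n \<le> ?n * (t + t\<^sup>2)"
      by (simp add: algebra_simps)
    moreover have "moment_const CARD('i) m M \<eta> * (t + t\<^sup>2) =
        ?n * (t + t\<^sup>2) + 2 * drift_const CARD('i) m M * (M\<^sup>2 * (t + t\<^sup>2)) / (\<eta> * m)"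
      by (simp add: moment_const_def distrib_right mult.assoc)
    ultimately show "t * ?n + 2 * drift_const CARD('i) m M * (?s + ?s\<^sup>2) / (\<eta> * m) \<le> moment_const CARD('i) m M \<eta> * (t + t\<^sup>2)"
      by linarith
  qed simp
  finally show ?thesis .
qed

lemma scaled_total_eq: "scaled_total lam \<mu> r f x = (\<Sum>l\<in>UNIV. sz x l)"
  by (simp add: scaled_total_def scaled_class_eq)

lemma neg_part_moment:
  assumes p: "stationary_distribution S P p" and \<nu>: "\<And>l. \<nu> l \<le> \<mu> l"
    and t: "0 < t" "t * M / sqrt (real r) \<le> m"
  shows "(\<integral>\<^sup>+x. ennreal (exp (t * neg_part (scaled_total lam \<mu> r f x))) \<partial>measure_pmf p)
    \<le> ennreal (2 * exp (moment_const CARD('i) m M 1 * (t + t\<^sup>2)))"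
proof -
  have "neg_part (scaled_total lam \<mu> r f x) \<le> excess (-1) x" for x
  proof -
    have "- (\<Sum>l\<in>UNIV. sz x l) \<le> excess (-1) x"
      unfolding excess_def sum_negf[symmetric] by (intro sum_mono) auto
    then show ?thesis
      using excess_nonneg[of "-1" x] by (auto simp: neg_part_def scaled_total_eq min_def)
  qed
  then have "(\<integral>\<^sup>+x. ennreal (exp (t * neg_part (scaled_total lam \<mu> r f x))) \<partial>measure_pmf p)
      \<le> (\<integral>\<^sup>+x. ennreal (exp (t * excess (-1) x)) \<partial>measure_pmf p)"
    using t by (intro nn_integral_mono ennreal_leI) simp
  also have "\<dots> \<le> ennreal (2 * exp (moment_const CARD('i) m M 1 * (t + t\<^sup>2)))"
  proof (rule excess_moment[OF p t(1)])
    fix x assume "x \<in> S"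
    then show "(\<Sum>l\<in>UNIV. class_drift (-1) (t * M) x l)
        \<le> - (t * M) * 1 * excess (-1) x + drift_const CARD('i) m M * (t * M + (t * M)\<^sup>2)"
      using total_drift_neg[of x "t * M"] t M \<nu> by (simp add: \<delta>_def)
  qed simp
  finally show ?thesis .
qed

lemma pos_part_moment:
  assumes p: "stationary_distribution S P p"
    and \<epsilon>: "0 < \<epsilon>" "\<epsilon> \<le> 1" "\<And>l. \<epsilon> * \<mu> l \<le> \<nu> l"
    and t: "0 < t" "t * M / sqrt (real r) \<le> m"
    and small: "drift_const CARD('i) m M * (1 + t * M) / sqrt (real r) \<le> \<epsilon> / 2"
  shows "(\<integral>\<^sup>+x. ennreal (exp (t * pos_part (scaled_total lam \<mu> r f x))) \<partial>measure_pmf p)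
    \<le> ennreal (2 * exp (moment_const CARD('i) m M (\<epsilon> / 2) * (t + t\<^sup>2)))"
proof -
  have "pos_part (scaled_total lam \<mu> r f x) \<le> excess 1 x" for x
  proof -
    have "(\<Sum>l\<in>UNIV. sz x l) \<le> excess 1 x"
      unfolding excess_def by (intro sum_mono) auto
    then show ?thesis
      using excess_nonneg[of 1 x] by (auto simp: pos_part_def scaled_total_eq max_def)
  qed
  then have "(\<integral>\<^sup>+x. ennreal (exp (t * pos_part (scaled_total lam \<mu> r f x))) \<partial>measure_pmf p)
      \<le> (\<integral>\<^sup>+x. ennreal (exp (t * excess 1 x)) \<partial>measure_pmf p)"
    using t by (intro nn_integral_mono ennreal_leI) simp
  also have "\<dots> \<le> ennreal (2 * exp (moment_const CARD('i) m M (\<epsilon> / 2) * (t + t\<^sup>2)))"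
  proof (rule excess_moment[OF p t(1)])
    fix x assume "x \<in> S"
    then show "(\<Sum>l\<in>UNIV. class_drift 1 (t * M) x l)
        \<le> - (t * M) * (\<epsilon> / 2) * excess 1 x + drift_const CARD('i) m M * (t * M + (t * M)\<^sup>2)"
      using t M \<epsilon> small by (intro total_drift_pos) (auto simp: \<delta>_def)
  qed (use \<epsilon> in simp)
  finally show ?thesis .
qed

end

end

section \<open>Gaussian moments of weak limits\<close>

text \<open>
  Completing the square, \<open>y\<^sup>2 / (4 B) \<le> B + j y - B j\<^sup>2\<close> for an integer \<open>j\<close> within distance 1 of \<open>y / (2 B)\<close>.
\<close>

lemma gaussian_moment_bound:
  fixes g :: "'w \<Rightarrow> real"
  assumes [measurable]: "g \<in> borel_measurable \<Omega>" and g: "\<And>\<omega>. 0 \<le> g \<omega>" and A: "0 \<le> A" "0 \<le> C"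
    and mgf: "\<And>t. 0 < t \<Longrightarrow> (\<integral>\<^sup>+\<omega>. ennreal (exp (t * g \<omega>)) \<partial>\<Omega>) \<le> ennreal (C * exp (A * (t + t\<^sup>2)))"
  shows "\<exists>\<theta>'>0. \<forall>\<theta>\<in>{0..\<theta>'}. (\<integral>\<^sup>+\<omega>. ennreal (exp (\<theta> * (g \<omega>)\<^sup>2)) \<partial>\<Omega>) < \<infinity>"
proof (intro exI conjI ballI)
  \<comment> \<open>The surplus 1 over \<open>A\<close> leaves \<open>- j^2\<close> in the exponent
    once the weight \<open>w\<close> meets the moment bound.\<close>
  define B where "B = A + 1"
  have B: "0 < B" using A by (simp add: B_def)
  show "0 < 1 / (4 * B)" using B by simp
  fix \<theta> assume \<theta>: "\<theta> \<in> {0..1 / (4 * B)}"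
  define w where "w k = ennreal (exp (B - B * (real (Suc k))\<^sup>2))" for k
  have pointwise: "ennreal (exp (\<theta> * y\<^sup>2)) \<le> (\<Sum>k. w k * ennreal (exp (real (Suc k) * y)))" if y: "0 \<le> y" for y
  proof -
    \<comment> \<open>The integer used is \<open>Suc k\<close>, at least 1, since the moment bound
      is given for positive \<open>t\<close> only.\<close>
    define k where "k = nat \<lfloor>y / (2 * B)\<rfloor>"
    have "0 \<le> y / (2 * B)" using y B by simp
    then have "\<bar>real (Suc k) - y / (2 * B)\<bar> \<le> 1"
      unfolding k_def by linarith
    then have sq: "(real (Suc k) - y / (2 * B))\<^sup>2 \<le> 1"
      by (simp add: abs_square_le_1)
    have "\<theta> * y\<^sup>2 \<le> 1 / (4 * B) * y\<^sup>2"
      using \<theta> by (intro mult_right_mono) auto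
    also have "\<dots> \<le> 1 / (4 * B) * y\<^sup>2 + B * (1 - (real (Suc k) - y / (2 * B))\<^sup>2)"
      using sq B by simp
    also have "\<dots> = B - B * (real (Suc k))\<^sup>2 + real (Suc k) * y"
    proof -
      define j where "j = real (Suc k)"
      show ?thesis
        unfolding j_def[symmetric] using B by (simp add: power2_eq_square field_simps)
    qed
    finally have "ennreal (exp (\<theta> * y\<^sup>2)) \<le> w k * ennreal (exp (real (Suc k) * y))"
      unfolding w_def by (simp add: ennreal_mult'[symmetric] exp_add[symmetric] ennreal_leI)
    also have "\<dots> \<le> (\<Sum>k. w k * ennreal (exp (real (Suc k) * y)))"
      using sum_le_suminf[of "\<lambda>k. w k * ennreal (exp (real (Suc k) * y))" "{k}"] by simp
    finally show ?thesis .
  qed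
  have "(\<integral>\<^sup>+\<omega>. ennreal (exp (\<theta> * (g \<omega>)\<^sup>2)) \<partial>\<Omega>)
      \<le> (\<integral>\<^sup>+\<omega>. (\<Sum>k. w k * ennreal (exp (real (Suc k) * g \<omega>))) \<partial>\<Omega>)"
    by (intro nn_integral_mono pointwise g)
  also have "\<dots> = (\<Sum>k. w k * (\<integral>\<^sup>+\<omega>. ennreal (exp (real (Suc k) * g \<omega>)) \<partial>\<Omega>))"
    by (simp add: nn_integral_suminf nn_integral_cmult)
  also have "\<dots> \<le> (\<Sum>k. ennreal (C * exp (B + (A + 1)\<^sup>2 / 4) * exp (- 1) ^ Suc k))"
  proof (intro suminf_le)
    fix k
    define j where "j = real (Suc k)"
    have j: "0 < j" by (simp add: j_def)
    have "w k * (\<integral>\<^sup>+\<omega>. ennreal (exp (j * g \<omega>)) \<partial>\<Omega>) \<le> w k * ennreal (C * exp (A * (j + j\<^sup>2)))"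
      by (intro mult_left_mono mgf j) simp
    also have "\<dots> = ennreal (C * exp (B - B * j\<^sup>2 + A * (j + j\<^sup>2)))"
      unfolding w_def j_def[symmetric] using A by (simp add: ennreal_mult'[symmetric] exp_add mult_ac)
    also have "\<dots> \<le> ennreal (C * exp (B + (A + 1)\<^sup>2 / 4 - j))"
    proof (intro ennreal_leI mult_left_mono A, unfold exp_le_cancel_iff)
      \<comment> \<open>Completing the square trades \<open>- j^2\<close> for \<open>- j\<close> and
        a constant, which gives a geometric series.\<close>
      have "0 \<le> (j - (A + 1) / 2)\<^sup>2" by simp
      then show "B - B * j\<^sup>2 + A * (j + j\<^sup>2) \<le> B + (A + 1)\<^sup>2 / 4 - j"
        by (simp add: B_def power2_eq_square field_simps)
    qed
    also have "\<dots> = ennreal (C * exp (B + (A + 1)\<^sup>2 / 4) * exp (- 1) ^ Suc k)"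
      unfolding j_def by (simp add: exp_of_nat_mult[symmetric] exp_add[symmetric] mult.assoc algebra_simps)
    finally show "w k * (\<integral>\<^sup>+\<omega>. ennreal (exp (real (Suc k) * g \<omega>)) \<partial>\<Omega>)
        \<le> ennreal (C * exp (B + (A + 1)\<^sup>2 / 4) * exp (- 1) ^ Suc k)"
      unfolding j_def .
  qed auto
  also have "\<dots> < \<infinity>"
  proof -
    have "summable (\<lambda>k. C * exp (B + (A + 1)\<^sup>2 / 4) * exp (- 1 :: real) ^ Suc k)"
      by (intro summable_mult) (simp add: summable_mult summable_geometric)
    then show ?thesis
      using A by (subst suminf_ennreal2) auto
  qed
  finally show "(\<integral>\<^sup>+\<omega>. ennreal (exp (\<theta> * (g \<omega>)\<^sup>2)) \<partial>\<Omega>) < \<infinity>" .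
qed

text \<open>Weak convergence controls bounded continuous functions only, so \<open>exp (g y)\<close>
  is cut off at \<open>k\<close>, and Fatou's lemma removes the cut. An eventual bound suffices,
  which lets the threshold on \<open>n\<close> depend on the exponent.\<close>

lemma weak_limit_exp_moment:
  fixes Y :: "nat \<Rightarrow> 'x \<Rightarrow> real" and Z :: "'w \<Rightarrow> real"
  assumes "prob_space \<Omega>" and [measurable]: "Z \<in> borel_measurable \<Omega>"
    and conv: "weak_conv_m (\<lambda>n. distr (measure_pmf (p n)) borel (Y n)) (distr \<Omega> borel Z)"
    and g: "\<And>y. isCont g y" and C: "0 \<le> C"
    and bound: "\<forall>\<^sub>F n in sequentially. (\<integral>\<^sup>+x. ennreal (exp (g (Y n x))) \<partial>measure_pmf (p n)) \<le> ennreal C"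
  shows "(\<integral>\<^sup>+\<omega>. ennreal (exp (g (Z \<omega>))) \<partial>\<Omega>) \<le> ennreal C"
proof -
  interpret \<Omega>: prob_space \<Omega> by fact
  have rd: "real_distribution (distr (measure_pmf (p n)) borel (Y n))" for n
    by (intro prob_space.real_distribution_distr prob_space_measure_pmf) simp
  have rdZ: "real_distribution (distr \<Omega> borel Z)"
    by (intro \<Omega>.real_distribution_distr) simp
  have [measurable]: "g \<in> borel_measurable borel"
    using g by (intro borel_measurable_continuous_onI continuous_at_imp_continuous_on) auto
  define h where "h k y = min (exp (g y)) (real k)" for k :: nat and y
  have h: "0 \<le> h k y" "h k y \<le> real k" "h k y \<le> exp (g y)" for k y
    by (auto simp: h_def)
  have hm [measurable]: "h k \<in> borel_measurable borel" for k
    unfolding h_def by measurable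
  have trunc: "(\<integral>\<^sup>+\<omega>. ennreal (h k (Z \<omega>)) \<partial>\<Omega>) \<le> ennreal C" for k
  proof -
    have "(\<lambda>n. \<integral>y. h k y \<partial>distr (measure_pmf (p n)) borel (Y n)) \<longlonglongrightarrow> (\<integral>y. h k y \<partial>distr \<Omega> borel Z)"
    proof (rule weak_conv_imp_integral_bdd_continuous_conv[OF rd rdZ conv])
      show "isCont (h k) y" for y
        unfolding h_def by (intro continuous_intros g)
      show "norm (h k y) \<le> real k" for y
        using h[of k y] by simp
    qed
    moreover have "\<forall>\<^sub>F n in sequentially. (\<integral>y. h k y \<partial>distr (measure_pmf (p n)) borel (Y n)) \<le> C"
      using bound
    proof eventually_elim
      case (elim n)
      have "ennreal (\<integral>x. h k (Y n x) \<partial>measure_pmf (p n)) = (\<integral>\<^sup>+x. ennreal (h k (Y n x)) \<partial>measure_pmf (p n))"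
        using h by (intro nn_integral_eq_integral[symmetric] measure_pmf.integrable_const_bound[where B = "real k"]) auto
      also have "\<dots> \<le> (\<integral>\<^sup>+x. ennreal (exp (g (Y n x))) \<partial>measure_pmf (p n))"
        using h by (intro nn_integral_mono ennreal_leI)
      also note elim
      finally show ?case
        using C by (subst integral_distr) auto
    qed
    ultimately have "(\<integral>y. h k y \<partial>distr \<Omega> borel Z) \<le> C"
      by (rule tendsto_upperbound) simp
    then have "(\<integral>\<omega>. h k (Z \<omega>) \<partial>\<Omega>) \<le> C"
      by (simp add: integral_distr)
    moreover have "(\<integral>\<^sup>+\<omega>. ennreal (h k (Z \<omega>)) \<partial>\<Omega>) = ennreal (\<integral>\<omega>. h k (Z \<omega>) \<partial>\<Omega>)"
      using h by (intro nn_integral_eq_integral \<Omega>.integrable_const_bound[where B = "real k"]) auto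
    ultimately show ?thesis
      by (simp add: ennreal_leI)
  qed
  have "(\<integral>\<^sup>+\<omega>. ennreal (exp (g (Z \<omega>))) \<partial>\<Omega>) = (\<integral>\<^sup>+\<omega>. liminf (\<lambda>k. ennreal (h k (Z \<omega>))) \<partial>\<Omega>)"
  proof (intro nn_integral_cong)
    fix \<omega>
    have "\<forall>\<^sub>F k in sequentially. h k (Z \<omega>) = exp (g (Z \<omega>))"
      using eventually_ge_at_top[of "nat \<lceil>exp (g (Z \<omega>))\<rceil>"]
      by eventually_elim (auto simp: h_def min_def nat_le_iff ceiling_le_iff)
    then have "(\<lambda>k. ennreal (h k (Z \<omega>))) \<longlonglongrightarrow> ennreal (exp (g (Z \<omega>)))"
      by (intro tendsto_eventually) (auto elim: eventually_mono)
    then show "ennreal (exp (g (Z \<omega>))) = liminf (\<lambda>k. ennreal (h k (Z \<omega>)))"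
      by (simp add: lim_imp_Liminf)
  qed
  also have "\<dots> \<le> liminf (\<lambda>k. \<integral>\<^sup>+\<omega>. ennreal (h k (Z \<omega>)) \<partial>\<Omega>)"
    by (rule nn_integral_liminf) simp
  also have "\<dots> \<le> liminf (\<lambda>k::nat. ennreal C)"
    using trunc by (intro Liminf_mono always_eventually allI)
  finally show ?thesis
    by (simp add: Liminf_const)
qed

section \<open>From uniform exponential moments to both tails of the limit\<close>

theorem theorem4:
  fixes lam \<mu> \<nu> :: "'i::finite \<Rightarrow> real" and a :: real
    and S :: "nat \<Rightarrow> 'x set" and q :: "nat \<Rightarrow> 'x \<Rightarrow> 'x \<Rightarrow> real"
    and P :: "nat \<Rightarrow> real \<Rightarrow> 'x \<Rightarrow> 'x pmf"
    and f :: "nat \<Rightarrow> 'x \<Rightarrow> ('i \<Rightarrow> nat) \<times> ('i \<Rightarrow> nat)"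
    and \<pi> :: "nat \<Rightarrow> 'x pmf"
    and rs :: "nat \<Rightarrow> nat" and \<Omega> :: "'w measure" and Z :: "'w \<Rightarrow> real"
  assumes "0 < a"
    and "\<And>i. 0 < lam i" and "\<And>i. 0 < \<mu> i" and "\<And>i. 0 \<le> \<nu> i"
    and "(\<Sum>i\<in>UNIV. lam i / \<mu> i) = 1"
    and "\<And>r. 1 \<le> r \<Longrightarrow> queueing_system (S r) (q r) (P r) lam \<mu> \<nu> a r (f r)"
    and "\<And>r. 1 \<le> r \<Longrightarrow> stationary_distribution (S r) (P r) (\<pi> r)"
    and "strict_mono rs" and "\<And>n. 1 \<le> rs n"
    and "prob_space \<Omega>" and "Z \<in> borel_measurable \<Omega>"
    and "weak_conv_m
           (\<lambda>n. distr (measure_pmf (\<pi> (rs n))) borel (scaled_total lam \<mu> (rs n) (f (rs n))))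
           (distr \<Omega> borel Z)"
  shows "((\<forall>i. \<nu> i \<le> \<mu> i) \<longrightarrow>
           (\<exists>\<theta>'>0. \<forall>\<theta>\<in>{0..\<theta>'}.
             (\<integral>\<^sup>+\<omega>. ennreal (exp (\<theta> * (neg_part (Z \<omega>))\<^sup>2)) \<partial>\<Omega>) < \<infinity>))
       \<and> ((\<forall>i. 0 < \<nu> i) \<longrightarrow>
           (\<exists>\<theta>'>0. \<forall>\<theta>\<in>{0..\<theta>'}.
             (\<integral>\<^sup>+\<omega>. ennreal (exp (\<theta> * (pos_part (Z \<omega>))\<^sup>2)) \<partial>\<Omega>) < \<infinity>))"
proof -
  \<comment> \<open>\<open>m \<le> 1 \<le> M\<close> are common bounds for the finitely many rates,
    independent of \<open>r\<close>.\<close>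
  define m where "m = min 1 (Min (range \<mu>))"
  define M where "M = 1 + (\<Sum>i\<in>UNIV. lam i + \<mu> i + \<nu> i)"
  have m: "0 < m" "m \<le> 1" "m \<le> \<mu> i" for i
    using assms(3) by (auto simp: m_def min_le_iff_disj)
  have le_M: "lam i + \<mu> i + \<nu> i \<le> M - 1" for i
    unfolding M_def using assms(2-4)
    by (simp add: member_le_sum[of i UNIV "\<lambda>i. lam i + \<mu> i + \<nu> i"] add_nonneg_nonneg less_imp_le)
  have M: "1 \<le> M" "lam i \<le> M" "\<mu> i \<le> M" "\<nu> i \<le> M" for i
    using le_M[of i] assms(2)[of i] assms(3)[of i] assms(4)[of i] by linarith+
  have queue: "critical_queue (S r) (q r) (P r) lam \<mu> \<nu> a r (f r)" if "1 \<le> r" for r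
    unfolding critical_queue_def critical_queue_axioms_def using assms that by auto
  have small: "\<forall>\<^sub>F n in sequentially. c / sqrt (real (rs n)) \<le> d" if "0 < d" for c d :: real
  proof -
    have "(\<lambda>r. c / sqrt (real r)) \<longlonglongrightarrow> 0"
      by real_asymp
    then have "((\<lambda>n. c / sqrt (real (rs n))) \<longlonglongrightarrow> 0)"
      using filterlim_compose[OF _ filterlim_subseq[OF assms(8)]] by blast
    from order_tendstoD(2)[OF this that] show ?thesis
      by eventually_elim simp
  qed
  \<comment> \<open>Shared by both parts: for each fixed \<open>t\<close> the bound needs to hold
    only far along the subsequence, while \<open>A\<close> must not depend on
    \<open>t\<close>.\<close>
  have conclude: "\<exists>\<theta>'>0. \<forall>\<theta>\<in>{0..\<theta>'}. (\<integral>\<^sup>+\<omega>. ennreal (exp (\<theta> * (g (Z \<omega>))\<^sup>2)) \<partial>\<Omega>) < \<infinity>"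
    if g: "\<And>y. isCont g y" "\<And>y. 0 \<le> g y" and A: "0 \<le> A"
      and bound: "\<And>t. 0 < t \<Longrightarrow> \<forall>\<^sub>F n in sequentially.
        (\<integral>\<^sup>+x. ennreal (exp (t * g (scaled_total lam \<mu> (rs n) (f (rs n)) x))) \<partial>measure_pmf (\<pi> (rs n)))
          \<le> ennreal (2 * exp (A * (t + t\<^sup>2)))"
    for g :: "real \<Rightarrow> real" and A
  proof (rule gaussian_moment_bound[OF _ _ A])
    have [measurable]: "g \<in> borel_measurable borel"
      using g by (intro borel_measurable_continuous_onI continuous_at_imp_continuous_on) auto
    show "(\<lambda>\<omega>. g (Z \<omega>)) \<in> borel_measurable \<Omega>"
      using assms(11) by measurable
    show "(\<integral>\<^sup>+\<omega>. ennreal (exp (t * g (Z \<omega>))) \<partial>\<Omega>) \<le> ennreal (2 * exp (A * (t + t\<^sup>2)))" if "0 < t" for t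
      by (rule weak_limit_exp_moment[OF assms(10-12) _ _ bound[OF that]]) (auto intro!: continuous_intros g)
  qed (use g in auto)
  have "\<exists>\<theta>'>0. \<forall>\<theta>\<in>{0..\<theta>'}. (\<integral>\<^sup>+\<omega>. ennreal (exp (\<theta> * (neg_part (Z \<omega>))\<^sup>2)) \<partial>\<Omega>) < \<infinity>"
    if \<nu>: "\<forall>i. \<nu> i \<le> \<mu> i"
  proof (rule conclude)
    show "isCont neg_part y" for y
      unfolding neg_part_def by (intro continuous_intros)
    fix t :: real assume t: "0 < t"
    show "\<forall>\<^sub>F n in sequentially.
        (\<integral>\<^sup>+x. ennreal (exp (t * neg_part (scaled_total lam \<mu> (rs n) (f (rs n)) x))) \<partial>measure_pmf (\<pi> (rs n)))
          \<le> ennreal (2 * exp (moment_const CARD('i) m M 1 * (t + t\<^sup>2)))"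
      using small[OF m(1), of "t * M"]
    proof eventually_elim
      case (elim n)
      interpret critical_queue "S (rs n)" "q (rs n)" "P (rs n)" lam \<mu> \<nu> a "rs n" "f (rs n)"
        by (rule queue[OF assms(9)])
      show ?case
        using \<nu> by (intro neg_part_moment m M assms(7) assms(9) t elim) auto
    qed
  qed (auto simp: neg_part_def intro!: moment_const_nonneg m(1) order_trans[OF _ M(1)])
  moreover have "\<exists>\<theta>'>0. \<forall>\<theta>\<in>{0..\<theta>'}. (\<integral>\<^sup>+\<omega>. ennreal (exp (\<theta> * (pos_part (Z \<omega>))\<^sup>2)) \<partial>\<Omega>) < \<infinity>"
    if \<nu>: "\<forall>i. 0 < \<nu> i"
  proof (rule conclude)
    \<comment> \<open>Positive because there are finitely many classes; capped at 1 so that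
      \<open>1 - \<epsilon>\<close> is nonnegative.\<close>
    define \<epsilon> where "\<epsilon> = min 1 (Min (range (\<lambda>i. \<nu> i / \<mu> i)))"
    have \<epsilon>: "0 < \<epsilon>" "\<epsilon> \<le> 1"
      using \<nu> assms(3) by (auto simp: \<epsilon>_def)
    have "\<epsilon> \<le> \<nu> i / \<mu> i" for i
      by (auto simp: \<epsilon>_def min_le_iff_disj)
    then have \<epsilon>': "\<epsilon> * \<mu> i \<le> \<nu> i" for i
      using assms(3)[of i] by (simp add: pos_le_divide_eq[symmetric])
    show "isCont pos_part y" for y
      unfolding pos_part_def by (intro continuous_intros)
    show "0 \<le> moment_const CARD('i) m M (\<epsilon> / 2)"
      using \<epsilon> by (auto intro!: moment_const_nonneg m(1) order_trans[OF _ M(1)])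
    fix t :: real assume t: "0 < t"
    have "\<forall>\<^sub>F n in sequentially. drift_const CARD('i) m M * (1 + t * M) / sqrt (real (rs n)) \<le> \<epsilon> / 2"
      using \<epsilon> by (intro small) simp
    with small[OF m(1), of "t * M"] show "\<forall>\<^sub>F n in sequentially.
        (\<integral>\<^sup>+x. ennreal (exp (t * pos_part (scaled_total lam \<mu> (rs n) (f (rs n)) x))) \<partial>measure_pmf (\<pi> (rs n)))
          \<le> ennreal (2 * exp (moment_const CARD('i) m M (\<epsilon> / 2) * (t + t\<^sup>2)))"
    proof eventually_elim
      case (elim n)
      interpret critical_queue "S (rs n)" "q (rs n)" "P (rs n)" lam \<mu> \<nu> a "rs n" "f (rs n)"
        by (rule queue[OF assms(9)])
      show ?case
        by (intro pos_part_moment m M assms(7) assms(9) \<epsilon> \<epsilon>' t elim)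
    qed
  qed (auto simp: pos_part_def)
  ultimately show ?thesis
    by blast
qed

end
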